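(* Let $k>0$ and let $A$ be the operator on $L^2(0,1)$ defined by $Af=-if''$ with domain $D(A)=\{f\in H^2(0,1): f(0)=0,\ f'(1)=-ikf(1)\}$. Then $\sup_{\omega\in\mathbb{R}}\|(i\omega-A)^{-1}\|<\infty$ (operator norm on $L^2(0,1)$). As a consequence, the $C_0$-semigroup $e^{At}$ generated by $A$ is exponentially stable in $L^2(0,1)$, i.e. there are constants $M>0$, $\mu>0$ with $\|e^{At}\|\le Me^{-\mu t}$ for all $t\ge0$.
   Context: $L^2(0,1)$ carries its standard inner product. $A$ generates a $C_0$-semigroup of contractions on $L^2(0,1)$; it is the generator of the closed-loop Schrödinger system $w_t=-iw_{xx}$, $w(0,t)=0$, $w_x(1,t)=-ikw(1,t)$. *)

theory Defs
  imports "HOL-Analysis.Analysis"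
begin

text \<open>Elements of L^2(0,1) are represented by complex-valued functions on the reals;
  only their values on [0,1] matter, and everything is stated modulo
  a.e. equality on [0,1].\<close>

definition L2 :: "(real \<Rightarrow> complex) set" where
  "L2 = {f. set_borel_measurable lborel {0..1} f \<and>
            set_integrable lborel {0..1} (\<lambda>x. complex_of_real ((cmod (f x))\<^sup>2))}"

definition L2norm :: "(real \<Rightarrow> complex) \<Rightarrow> real" where
  "L2norm f = sqrt (LINT x:{0..1}|lborel. (cmod (f x))\<^sup>2)"

definition L2eq :: "(real \<Rightarrow> complex) \<Rightarrow> (real \<Rightarrow> complex) \<Rightarrow> bool" where
  "L2eq f g \<longleftrightarrow> (AE x in lborel. x \<in> {0..1} \<longrightarrow> f x = g x)"

text \<open>h is the H^2(0,1) (continuous, C^1) representative with first derivative h1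
  (absolutely continuous) and second weak derivative h2 \<in> L^2(0,1).\<close>
definition H2_rep :: "(real \<Rightarrow> complex) \<Rightarrow> (real \<Rightarrow> complex) \<Rightarrow> (real \<Rightarrow> complex) \<Rightarrow> bool" where
  "H2_rep h h1 h2 \<longleftrightarrow> h2 \<in> L2 \<and>
     (\<forall>x\<in>{0..1}. h1 x = h1 0 + (LINT t:{0..x}|lborel. h2 t)) \<and>
     (\<forall>x\<in>{0..1}. h x = h 0 + (LINT t:{0..x}|lborel. h1 t))"

text \<open>Graph of the operator A f = -i f'' with
  D(A) = {f \<in> H^2(0,1) : f(0) = 0, f'(1) = -i k f(1)}, as a relation on L^2 classes:
  Agraph k f u means f \<in> D(A) and A f = u (in L^2).\<close>
definition Agraph :: "real \<Rightarrow> (real \<Rightarrow> complex) \<Rightarrow> (real \<Rightarrow> complex) \<Rightarrow> bool" where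
  "Agraph k f u \<longleftrightarrow> f \<in> L2 \<and> u \<in> L2 \<and>
     (\<exists>h h1 h2. H2_rep h h1 h2 \<and> L2eq f h \<and> h 0 = 0 \<and> h1 1 = - \<i> * complex_of_real k * h 1
        \<and> L2eq u (\<lambda>x. - \<i> * h2 x))"

definition C0_semigroup :: "(real \<Rightarrow> (real \<Rightarrow> complex) \<Rightarrow> (real \<Rightarrow> complex)) \<Rightarrow> bool" where
  "C0_semigroup T \<longleftrightarrow>
     (\<forall>t\<ge>0. \<forall>f\<in>L2. T t f \<in> L2) \<and>
     (\<forall>t\<ge>0. \<forall>f\<in>L2. \<forall>g\<in>L2. L2eq f g \<longrightarrow> L2eq (T t f) (T t g)) \<and>
     (\<forall>t\<ge>0. \<forall>f\<in>L2. \<forall>g\<in>L2. \<forall>a b::complex.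
        L2eq (T t (\<lambda>x. a * f x + b * g x)) (\<lambda>x. a * T t f x + b * T t g x)) \<and>
     (\<forall>t\<ge>0. \<exists>B. \<forall>f\<in>L2. L2norm (T t f) \<le> B * L2norm f) \<and>
     (\<forall>f\<in>L2. L2eq (T 0 f) f) \<and>
     (\<forall>t\<ge>0. \<forall>s\<ge>0. \<forall>f\<in>L2. L2eq (T (t + s) f) (T t (T s f))) \<and>
     (\<forall>f\<in>L2. ((\<lambda>t. L2norm (\<lambda>x. T t f x - f x)) \<longlongrightarrow> 0) (at_right 0))"

definition generated_by_A :: "real \<Rightarrow> (real \<Rightarrow> (real \<Rightarrow> complex) \<Rightarrow> (real \<Rightarrow> complex)) \<Rightarrow> bool" where
  "generated_by_A k T \<longleftrightarrow> C0_semigroup T \<and>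
     (\<forall>f\<in>L2. \<forall>u\<in>L2.
        ((\<lambda>h. L2norm (\<lambda>x. (T h f x - f x) / complex_of_real h - u x)) \<longlongrightarrow> 0) (at_right 0)
        \<longleftrightarrow> Agraph k f u)"

end

theory Submission
  imports Defs
begin

text \<open>
  Both claims follow from a Lyapunov functional. For \<open>f\<close> in the domain, the energy identity
  \<open>Re \<langle>A f, f\<rangle> = - k |f(1)|\<^sup>2\<close> only controls the boundary value. Put \<open>z(x) = - \<integral>\<^sub>x\<^sup>1 f\<close>; by the
  boundary condition at 1, applying the same map to \<open>A f\<close> gives \<open>- i z'' + k f(1)\<close>, so \<open>z\<close> sees
  the dynamics only through a term that the dissipation controls. The multiplier \<open>x z'\<close> then shows that
  the bounded quadratic form \<open>Im \<langle>x z, f\<rangle>\<close> has derivative \<open>2 \<parallel>f\<parallel>\<^sup>2 - |f(1)|\<^sup>2 + k Im (f(1) \<integral>\<^sub>0\<^sup>1 x cnj f)\<close>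
  along \<open>A\<close>. Hence for small \<open>\<epsilon> > 0\<close> the form
  \<open>Re \<langle>f, g\<rangle> - \<epsilon>/2 (Im \<langle>x z\<^sub>f, g\<rangle> + Im \<langle>x z\<^sub>g, f\<rangle>)\<close> is an equivalent inner product for which \<open>A + c\<close> is
  dissipative with some \<open>c > 0\<close>. This bounds the resolvent on the imaginary axis uniformly and yields the
  exponential decay of orbits in the domain, which is dense.
\<close>

section \<open>The space L^2(0,1)\<close>

text \<open>The obstacle is regularity. The classical multiplier form \<open>Im <x f, f'>\<close>
  lives on H^1 and is not bounded on L^2. Passing to an antiderivative lowers everything by one
  derivative: since z' = f, \<open>Im <x z, f>\<close> is the same expression for z, yet it is
  bounded by a multiple of the squared L^2 norm of f. The antiderivative is normalised at 1 because
  its analogue for A f then brings in f'(1), which the boundary condition turns into f(1);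
  normalising at 0 would bring in f'(0), over which the dissipation gives no control.

  The resolvent bound doubles as a uniqueness statement, and existence is deduced from it by a
  shooting argument. The decay estimate is obtained from the dissipativity itself, by
  differentiating the form along orbits. Here the obstacle is that \<open>C0_semigroup\<close>
  bounds each \<open>T t\<close> separately and asks for continuity only at time 0 from the right.
  Left continuity of orbits therefore needs a local bound that is uniform in time, and monotonicity
  has to be concluded from right derivatives alone.\<close>

text \<open>With the measure restricted to [0,1], the set integrals of the definitions become plain
  integrals over a finite measure, where bounded measurable functions are integrable.\<close>

definition I01 :: "real measure" where "I01 = restrict_space lborel {0..1}"

lemma space_I01: "space I01 = {0..1}"
  by (simp add: I01_def space_restrict_space)

lemma finite_measure_I01: "finite_measure I01"
  unfolding I01_def by (rule finite_measureI) (simp add: emeasure_restrict_space)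

interpretation I01: finite_measure I01 by (rule finite_measure_I01)

lemma measure_I01: "measure I01 {0..1} = 1"
  by (simp add: I01_def measure_restrict_space)

lemma AE_I01: "(AE x in I01. P x) \<longleftrightarrow> (AE x in lborel. x \<in> {0..1} \<longrightarrow> P x)"
  unfolding I01_def by (rule AE_restrict_space_iff) simp

lemma integrable_I01:
  fixes f :: "real \<Rightarrow> 'b::{banach, second_countable_topology}"
  shows "integrable I01 f \<longleftrightarrow> set_integrable lborel {0..1} f"
  by (simp add: I01_def set_integrable_def integrable_restrict_space)

lemma integral_I01:
  fixes f :: "real \<Rightarrow> 'b::{banach, second_countable_topology}"
  shows "integral\<^sup>L I01 f = (LINT x:{0..1}|lborel. f x)"
  by (simp add: I01_def set_lebesgue_integral_def integral_restrict_space)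

lemma borel_measurable_I01: 
  fixes f :: "real \<Rightarrow> 'b::real_normed_vector"
  shows "f \<in> borel_measurable I01 \<longleftrightarrow> set_borel_measurable lborel {0..1} f"
  by (simp add: I01_def set_borel_measurable_def borel_measurable_restrict_space_iff)

lemma borel_measurable_I01_continuous:
  fixes f :: "real \<Rightarrow> 'b::topological_space"
  assumes "continuous_on {0..1} f" shows "f \<in> borel_measurable I01"
  unfolding I01_def using borel_measurable_continuous_on_restrict[OF assms]
  by (simp add: measurable_def space_restrict_space sets_restrict_space)

lemma integrable_I01_bounded:
  fixes f :: "real \<Rightarrow> 'b::{banach, second_countable_topology}"
  assumes "f \<in> borel_measurable I01" "\<And>x. x \<in> {0..1} \<Longrightarrow> norm (f x) \<le> B"
  shows "integrable I01 f"
  using assms by (intro I01.integrable_const_bound[where B=B]) (auto simp: space_I01 intro!: AE_I2)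

lemma integrable_I01_continuous:
  fixes f :: "real \<Rightarrow> 'b::{banach, second_countable_topology}"
  assumes "continuous_on {0..1} f" shows "integrable I01 f"
proof -
  have "bounded (f ` {0..1})" using assms by (intro compact_imp_bounded compact_continuous_image) auto
  then obtain B where "\<And>x. x \<in> {0..1} \<Longrightarrow> norm (f x) \<le> B" unfolding bounded_iff by (meson imageI)
  then show ?thesis
    using borel_measurable_I01_continuous[OF assms] by (rule integrable_I01_bounded[rotated])
qed

lemma L2_iff: "f \<in> L2 \<longleftrightarrow> f \<in> borel_measurable I01 \<and> integrable I01 (\<lambda>x. (cmod (f x))\<^sup>2)"
  unfolding L2_def borel_measurable_I01 integrable_I01[symmetric] complex_of_real_integrable_eq by simp

lemma L2_measurable: "f \<in> L2 \<Longrightarrow> f \<in> borel_measurable I01" by (simp add: L2_iff)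

lemma L2_integrable_square: "f \<in> L2 \<Longrightarrow> integrable I01 (\<lambda>x. (cmod (f x))\<^sup>2)" by (simp add: L2_iff)

lemma L2norm_I01: "L2norm f = sqrt (\<integral>x. (cmod (f x))\<^sup>2 \<partial>I01)"
  by (simp add: L2norm_def integral_I01)

lemma L2norm_nonneg [simp]: "0 \<le> L2norm f"
  by (simp add: L2norm_I01)

lemma L2norm_power2: "(L2norm f)\<^sup>2 = (\<integral>x. (cmod (f x))\<^sup>2 \<partial>I01)"
  by (simp add: L2norm_I01)

lemma L2eq_I01: "L2eq f g \<longleftrightarrow> (AE x in I01. f x = g x)"
  by (simp add: L2eq_def AE_I01)

lemma L2eq_sym: "L2eq f g \<Longrightarrow> L2eq g f"
  unfolding L2eq_def by (auto elim!: eventually_mono)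

lemma L2eq_trans: "L2eq f g \<Longrightarrow> L2eq g h \<Longrightarrow> L2eq f h"
  unfolding L2eq_I01 by (elim AE_mp) (auto intro!: AE_I2)

lemma L2_bounded:
  assumes "f \<in> borel_measurable I01" "\<And>x. x \<in> {0..1} \<Longrightarrow> cmod (f x) \<le> B"
  shows "f \<in> L2"
  unfolding L2_iff using assms
  by (auto intro!: integrable_I01_bounded[where B="B\<^sup>2"] power_mono)

lemma L2_continuous: "continuous_on {0..1} f \<Longrightarrow> f \<in> L2"
  unfolding L2_iff 
  by (auto intro!: borel_measurable_I01_continuous integrable_I01_continuous continuous_intros)

lemma L2_mult_bounded:
  assumes "f \<in> L2" "c \<in> borel_measurable I01" "\<And>x. x \<in> {0..1} \<Longrightarrow> cmod (c x) \<le> B"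
  shows "(\<lambda>x. c x * f x) \<in> L2"
proof -
  have "integrable I01 (\<lambda>x. B\<^sup>2 * (cmod (f x))\<^sup>2)"
    using L2_integrable_square[OF assms(1)] by simp
  then have "integrable I01 (\<lambda>x. (cmod (c x * f x))\<^sup>2)"
    by (rule Bochner_Integration.integrable_bound)
       (use assms L2_measurable[OF assms(1)] in \<open>auto simp: space_I01 norm_mult power_mult_distrib intro!: AE_I2 power_mono mult_right_mono\<close>)
  then show ?thesis using assms L2_measurable[OF assms(1)] by (simp add: L2_iff)
qed

lemma L2_cmult: "f \<in> L2 \<Longrightarrow> (\<lambda>x. c * f x) \<in> L2"
  by (rule L2_mult_bounded[where B="cmod c"]) auto

lemma L2_add:
  assumes "f \<in> L2" "g \<in> L2" shows "(\<lambda>x. f x + g x) \<in> L2"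
proof -
  note [measurable] = assms[THEN L2_measurable]
  have "integrable I01 (\<lambda>x. 2 * (cmod (f x))\<^sup>2 + 2 * (cmod (g x))\<^sup>2)"
    using assms by (simp add: L2_iff)
  then have "integrable I01 (\<lambda>x. (cmod (f x + g x))\<^sup>2)"
  proof (rule Bochner_Integration.integrable_bound)
    have "(cmod (a + b))\<^sup>2 \<le> 2 * (cmod a)\<^sup>2 + 2 * (cmod b)\<^sup>2" for a b
    proof -
      have "(cmod (a + b))\<^sup>2 \<le> (cmod a + cmod b)\<^sup>2" by (simp add: norm_triangle_ineq power_mono)
      also have "\<dots> \<le> 2 * (cmod a)\<^sup>2 + 2 * (cmod b)\<^sup>2"
        using sum_squares_bound[of "cmod a" "cmod b"] by (simp add: power2_sum)
      finally show ?thesis .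
    qed
    then show "AE x in I01. norm ((cmod (f x + g x))\<^sup>2) \<le> norm (2 * (cmod (f x))\<^sup>2 + 2 * (cmod (g x))\<^sup>2)"
      by (intro AE_I2) simp
  qed measurable
  then show ?thesis using assms by (simp add: L2_iff)
qed

lemma L2_lincomb: "f \<in> L2 \<Longrightarrow> g \<in> L2 \<Longrightarrow> (\<lambda>x. a * f x + b * g x) \<in> L2"
  by (intro L2_add L2_cmult)

lemma L2_diff: "f \<in> L2 \<Longrightarrow> g \<in> L2 \<Longrightarrow> (\<lambda>x. f x - g x) \<in> L2"
  using L2_lincomb[of f g 1 "-1"] by simp

lemma L2_integrable_mult:
  assumes "f \<in> L2" "g \<in> L2" shows "integrable I01 (\<lambda>x. cmod (f x) * cmod (g x))"
proof -
  note [measurable] = assms[THEN L2_measurable]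
  have "integrable I01 (\<lambda>x. (cmod (f x))\<^sup>2 + (cmod (g x))\<^sup>2)"
    using assms by (simp add: L2_iff)
  then show ?thesis
  proof (rule Bochner_Integration.integrable_bound)
    have "cmod a * cmod b \<le> (cmod a)\<^sup>2 + (cmod b)\<^sup>2" for a b
      using sum_squares_bound[of "cmod a" "cmod b"] mult_nonneg_nonneg[of "cmod a" "cmod b"] 
        norm_ge_zero[of a] norm_ge_zero[of b] by linarith
    then show "AE x in I01. norm (cmod (f x) * cmod (g x)) \<le> norm ((cmod (f x))\<^sup>2 + (cmod (g x))\<^sup>2)"
      by (intro AE_I2) simp
  qed measurable
qed

lemma L2_integrable: "f \<in> L2 \<Longrightarrow> integrable I01 f"
  using L2_integrable_mult[of f "\<lambda>_. 1"] L2_bounded[of "\<lambda>_. 1" 1] integrable_norm_cancel[of I01 f] L2_measurable[of f]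
  by simp

section \<open>Inner product, Cauchy-Schwarz and compatibility with a.e. equality\<close>

lemma borel_measurable_cnj [measurable]: "cnj \<in> borel_measurable borel"
  by (intro borel_measurable_continuous_onI continuous_intros)

definition ip :: "(real \<Rightarrow> complex) \<Rightarrow> (real \<Rightarrow> complex) \<Rightarrow> complex" where
  "ip f g = (\<integral>x. f x * cnj (g x) \<partial>I01)"

lemma ip_integrable:
  assumes "f \<in> L2" "g \<in> L2" shows "integrable I01 (\<lambda>x. f x * cnj (g x))"
proof -
  note [measurable] = assms[THEN L2_measurable]
  show ?thesis
    by (rule Bochner_Integration.integrable_bound[OF L2_integrable_mult[OF assms]]) (auto simp: norm_mult)
qed

lemma ip_lincomb_left:
  "f \<in> L2 \<Longrightarrow> g \<in> L2 \<Longrightarrow> h \<in> L2 \<Longrightarrow> ip (\<lambda>x. a * f x + b * g x) h = a * ip f h + b * ip g h"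
  using ip_integrable[of f h] ip_integrable[of g h] unfolding ip_def 
  by (simp add: distrib_right mult.assoc)

lemma ip_cnj: "cnj (ip f g) = ip g f"
  unfolding ip_def by (subst Bochner_Integration.integral_cnj [symmetric]) (simp add: mult.commute)

lemma ip_lincomb_right:
  "f \<in> L2 \<Longrightarrow> g \<in> L2 \<Longrightarrow> h \<in> L2 \<Longrightarrow> ip h (\<lambda>x. a * f x + b * g x) = cnj a * ip h f + cnj b * ip h g"
  by (subst (1 2 3) ip_cnj [symmetric]) (simp add: ip_lincomb_left)

lemma ip_self: "ip f f = complex_of_real ((L2norm f)\<^sup>2)"
  unfolding ip_def L2norm_power2 by (simp add: complex_norm_square[symmetric] flip: integral_complex_of_real)

text \<open>The quadratic polynomial s -> integral of (s|f| - |g|)^2 is nonnegative, so its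
  discriminant is not positive. Keeping the moduli inside the integral serves the triangle
  inequality as well as \<open>ip_bound\<close>.\<close>

lemma integral_mult_le_L2norm:
  assumes "f \<in> L2" "g \<in> L2"
  shows "(\<integral>x. cmod (f x) * cmod (g x) \<partial>I01) \<le> L2norm f * L2norm g"
proof -
  define A B C where "A = (L2norm f)\<^sup>2" "B = (L2norm g)\<^sup>2" "C = (\<integral>x. cmod (f x) * cmod (g x) \<partial>I01)"
  have q: "0 \<le> s\<^sup>2 * A - 2 * s * C + B" for s
  proof -
    have "0 \<le> (\<integral>x. (s * cmod (f x) - cmod (g x))\<^sup>2 \<partial>I01)" by simp
    also have "\<dots> = (\<integral>x. s\<^sup>2 * (cmod (f x))\<^sup>2 - 2 * s * (cmod (f x) * cmod (g x)) + (cmod (g x))\<^sup>2 \<partial>I01)"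
      by (simp add: power2_diff power_mult_distrib algebra_simps)
    also have "\<dots> = s\<^sup>2 * A - 2 * s * C + B"
      using L2_integrable_mult[OF assms] L2_integrable_square[OF assms(1)] L2_integrable_square[OF assms(2)]
      by (simp add: A_B_C_def L2norm_power2)
    finally show ?thesis .
  qed
  have "C\<^sup>2 \<le> A * B"
  proof (cases "A = 0")
    case True
    have "C = 0"
    proof (rule ccontr)
      assume "C \<noteq> 0"
      \<comment> \<open>For \<open>A = 0\<close> the quadratic degenerates to an affine function,
        and this \<open>s\<close> gives it the value -1.\<close>
      with q[of "(B + 1) / (2 * C)"] True show False by simp
    qed
    with True show ?thesis by simp
  next
    case False
    then have "A > 0" by (simp add: A_B_C_def)
    \<comment> \<open>\<open>C / A\<close> minimises the quadratic.\<close>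
    with q[of "C / A"] show ?thesis by (simp add: field_simps power2_eq_square)
  qed
  then have "C\<^sup>2 \<le> (L2norm f * L2norm g)\<^sup>2" by (simp add: A_B_C_def power_mult_distrib)
  then show ?thesis unfolding A_B_C_def(3) by (rule power2_le_imp_le) simp
qed

lemma ip_bound:
  assumes "f \<in> L2" "g \<in> L2" shows "cmod (ip f g) \<le> L2norm f * L2norm g"
proof -
  have "cmod (ip f g) \<le> (\<integral>x. cmod (f x * cnj (g x)) \<partial>I01)"
    unfolding ip_def by (rule integral_norm_bound)
  also have "\<dots> \<le> L2norm f * L2norm g"
    using integral_mult_le_L2norm[OF assms] by (simp add: norm_mult)
  finally show ?thesis .
qed

lemma L2norm_triangle:
  assumes "f \<in> L2" "g \<in> L2" shows "L2norm (\<lambda>x. f x + g x) \<le> L2norm f + L2norm g"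
proof -
  have "(L2norm (\<lambda>x. f x + g x))\<^sup>2 \<le> (\<integral>x. (cmod (f x))\<^sup>2 + 2 * (cmod (f x) * cmod (g x)) + (cmod (g x))\<^sup>2 \<partial>I01)"
    unfolding L2norm_power2
  proof (rule integral_mono)
    show "(cmod (f x + g x))\<^sup>2 \<le> (cmod (f x))\<^sup>2 + 2 * (cmod (f x) * cmod (g x)) + (cmod (g x))\<^sup>2" for x
      using power_mono[OF norm_triangle_ineq[of "f x" "g x"], of 2] by (simp add: power2_sum algebra_simps)
  qed (use assms L2_add[OF assms] L2_integrable_mult[OF assms] in \<open>auto simp: L2_integrable_square\<close>)
  also have "\<dots> = (L2norm f)\<^sup>2 + 2 * (\<integral>x. cmod (f x) * cmod (g x) \<partial>I01) + (L2norm g)\<^sup>2"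
    using assms L2_integrable_mult[OF assms] by (simp add: L2_integrable_square L2norm_power2)
  also have "\<dots> \<le> (L2norm f + L2norm g)\<^sup>2"
    using integral_mult_le_L2norm[OF assms] by (simp add: power2_sum)
  finally show ?thesis by (rule power2_le_imp_le) simp
qed

lemma L2norm_minus_commute: "L2norm (\<lambda>x. f x - g x) = L2norm (\<lambda>x. g x - f x)"
  by (simp add: L2norm_I01 norm_minus_commute)

lemma L2norm_triangle_diff:
  assumes "f \<in> L2" "g \<in> L2" "h \<in> L2"
  shows "L2norm (\<lambda>x. f x - h x) \<le> L2norm (\<lambda>x. f x - g x) + L2norm (\<lambda>x. g x - h x)"
  using L2norm_triangle[OF L2_diff[OF assms(1,2)] L2_diff[OF assms(2,3)]] by simp

lemma L2norm_cong:
  assumes "f \<in> L2" "g \<in> L2" "L2eq f g" shows "L2norm f = L2norm g"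
  unfolding L2norm_I01
  using assms by (intro arg_cong[where f=sqrt] integral_cong_AE) (auto simp: L2eq_I01 dest: L2_measurable)

lemma ip_cong:
  assumes "f \<in> L2" "f' \<in> L2" "L2eq f f'" "g \<in> L2" "g' \<in> L2" "L2eq g g'"
  shows "ip f g = ip f' g'"
proof -
  note [measurable] = assms(1,2,4,5)[THEN L2_measurable]
  show ?thesis unfolding ip_def
  proof (rule integral_cong_AE)
  show "AE x in I01. f x * cnj (g x) = f' x * cnj (g' x)"
    using assms(3,6) unfolding L2eq_I01 by eventually_elim simp
  qed measurable
qed

lemma L2norm_eq_0_imp:
  assumes "f \<in> L2" "L2norm f = 0" shows "L2eq f (\<lambda>_. 0)"
proof -
  have "(\<integral>x. (cmod (f x))\<^sup>2 \<partial>I01) = 0" using assms(2) L2norm_power2[of f] by simp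
  then have "AE x in I01. (cmod (f x))\<^sup>2 = 0"
    by (subst (asm) integral_nonneg_eq_0_iff_AE) (use assms in \<open>auto simp: L2_iff\<close>)
  then show ?thesis by (simp add: L2eq_I01)
qed

lemma L2norm_diff_cong:
  assumes "f \<in> L2" "f' \<in> L2" "L2eq f f'" "g \<in> L2" "g' \<in> L2" "L2eq g g'"
  shows "L2norm (\<lambda>x. f x - g x) = L2norm (\<lambda>x. f' x - g' x)"
proof (rule L2norm_cong)
  show "L2eq (\<lambda>x. f x - g x) (\<lambda>x. f' x - g' x)"
    using assms(3,6) unfolding L2eq_I01 by eventually_elim simp
qed (use assms in \<open>auto intro: L2_diff\<close>)

lemma L2eq_refl: "L2eq f f" by (simp add: L2eq_def)

section \<open>Absolutely continuous functions\<close>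

definition primitive :: "(real \<Rightarrow> complex) \<Rightarrow> real \<Rightarrow> complex" where
  "primitive f x = (LINT t:{0..x}|lborel. f t)"

text \<open>Absolute continuity on [0,1], encoded by the integral formula that \<open>H2_rep\<close>
  uses; \<open>f\<close> matters only up to null sets, and \<open>F\<close> only on [0,1].\<close>

definition AC :: "(real \<Rightarrow> complex) \<Rightarrow> (real \<Rightarrow> complex) \<Rightarrow> bool" where
  "AC F f \<longleftrightarrow> integrable I01 f \<and> (\<forall>x\<in>{0..1}. F x = F 0 + primitive f x)"

lemma AC_integrable: "AC F f \<Longrightarrow> integrable I01 f"
  by (simp add: AC_def)

lemma AC_eq: "AC F f \<Longrightarrow> x \<in> {0..1} \<Longrightarrow> F x = F 0 + primitive f x"
  unfolding AC_def by blast

lemma primitive_0 [simp]: "primitive f 0 = 0"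
proof -
  have "AE x in lborel. indicator {0..0} x *\<^sub>R f x = 0"
    using AE_lborel_singleton[of 0] by eventually_elim (auto simp: indicator_def)
  then show ?thesis unfolding primitive_def set_lebesgue_integral_def by (rule integral_eq_zero_AE)
qed

lemma AC_primitive: "integrable I01 f \<Longrightarrow> AC (\<lambda>x. c + primitive f x) f"
  by (simp add: AC_def)

lemma set_integrable_prefix:
  assumes "integrable I01 f" "x \<in> {0..1}" 
  shows "set_integrable lborel {0..x} (f :: real \<Rightarrow> complex)"
  using assms unfolding integrable_I01 by (auto elim: set_integrable_subset)

lemma continuous_on_primitive:
  assumes "integrable I01 f" shows "continuous_on {0..1} (primitive f)"
proof -
  have "continuous_on {0..1} (\<lambda>x. integral {0..x} f)"
    using assms by (intro indefinite_integral_continuous_1 set_borel_integral_eq_integral(1)) (simp add: integrable_I01)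
  moreover have "integral {0..x} f = primitive f x" if "x \<in> {0..1}" for x
    using set_borel_integral_eq_integral(2)[OF set_integrable_prefix[OF assms that]] by (simp add: primitive_def)
  ultimately show ?thesis by (rule continuous_on_eq)
qed

lemma AC_continuous: 
  assumes "AC F f" shows "continuous_on {0..1} F"
proof -
  have "continuous_on {0..1} (\<lambda>x. F 0 + primitive f x)"
    using continuous_on_primitive[OF AC_integrable[OF assms]] by (intro continuous_intros)
  then show ?thesis by (rule continuous_on_eq) (rule AC_eq[OF assms, symmetric])
qed

lemma primitive_1: "primitive f 1 = (\<integral>x. f x \<partial>I01)"
  by (simp add: primitive_def integral_I01)

lemma AC_integral: "AC F f \<Longrightarrow> (\<integral>x. f x \<partial>I01) = F 1 - F 0"
  using AC_eq[of F f 1] by (simp add: primitive_1)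

lemma primitive_add:
  assumes "integrable I01 f" "integrable I01 g" "x \<in> {0..1}"
  shows "primitive (\<lambda>t. a * f t + b * g t) x = a * primitive f x + b * primitive g x"
  using set_integrable_prefix[OF assms(1,3)] set_integrable_prefix[OF assms(2,3)]
  by (simp add: primitive_def)

lemma AC_lincomb:
  assumes "AC F f" "AC G g" shows "AC (\<lambda>x. a * F x + b * G x) (\<lambda>x. a * f x + b * g x)"
proof -
  note i = AC_integrable[OF assms(1)] AC_integrable[OF assms(2)]
  have "a * F x + b * G x = a * F 0 + b * G 0 + primitive (\<lambda>x. a * f x + b * g x) x" if x: "x \<in> {0..1}" for x
    unfolding primitive_add[OF i x] AC_eq[OF assms(1) x] AC_eq[OF assms(2) x] by (simp add: algebra_simps)
  moreover have "integrable I01 (\<lambda>x. a * f x + b * g x)" using i by simp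
  ultimately show ?thesis unfolding AC_def by blast
qed

lemma AC_cnj:
  assumes "AC F f" shows "AC (\<lambda>x. cnj (F x)) (\<lambda>x. cnj (f x))"
proof -
  have "primitive (\<lambda>t. cnj (f t)) x = cnj (primitive f x)" for x
    unfolding primitive_def set_lebesgue_integral_def
    by (subst Bochner_Integration.integral_cnj [symmetric]) simp
  moreover have "cnj (F x) = cnj (F 0) + cnj (primitive f x)" if "x \<in> {0..1}" for x
    unfolding AC_eq[OF assms that] by simp
  ultimately show ?thesis using AC_integrable[OF assms] unfolding AC_def by (simp only: integrable_cnj) blast
qed

lemma AC_C1:
  assumes "continuous_on {0..1} f" "\<And>x. x \<in> {0..1} \<Longrightarrow> (F has_vector_derivative f x) (at x within {0..1})"
  shows "AC F f"
proof -
  have i: "integrable I01 f" using assms(1) by (rule integrable_I01_continuous)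
  have "F x = F 0 + primitive f x" if x: "x \<in> {0..1}" for x
  proof -
    have "(f has_integral (F x - F 0)) {0..x}"
    proof (rule fundamental_theorem_of_calculus)
      show "(F has_vector_derivative f t) (at t within {0..x})" if "t \<in> {0..x}" for t
        using x that by (intro has_vector_derivative_within_subset[OF assms(2)]) auto
    qed (use x in simp)
    moreover have "primitive f x = integral {0..x} f"
      using set_borel_integral_eq_integral(2)[OF set_integrable_prefix[OF i x]] by (simp add: primitive_def)
    ultimately show ?thesis by (simp add: integral_unique)
  qed
  with i show ?thesis unfolding AC_def by blast
qed

text \<open>Fubini over the two triangles s \<le> t and t \<le> s, which overlap in a null set.\<close>

lemma integral_by_parts_lborel:
  fixes f g :: "real \<Rightarrow> complex"
  assumes f: "integrable lborel f" and g: "integrable lborel g"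
  shows "(\<integral>t. f t * (\<integral>s. indicator {..t} s *\<^sub>R g s \<partial>lborel) \<partial>lborel)
       + (\<integral>s. (\<integral>t. indicator {..s} t *\<^sub>R f t \<partial>lborel) * g s \<partial>lborel)
       = (\<integral>t. f t \<partial>lborel) * (\<integral>s. g s \<partial>lborel)" (is "?L1 + ?L2 = _")
proof -
  note [measurable] = borel_measurable_integrable[OF f] borel_measurable_integrable[OF g]
  define h1 where "h1 t s = (if s \<le> t then f t * g s else 0)" for t s
  define h2 where "h2 t s = (if t \<le> s then f t * g s else 0)" for t s
  have fg: "integrable (lborel \<Otimes>\<^sub>M lborel) (\<lambda>(t, s). f t * g s)"
  proof (rule lborel_pair.Fubini_integrable)
    show "integrable lborel (\<lambda>x. LINT y|lborel. norm (case (x, y) of (t, s) \<Rightarrow> f t * g s))"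
      using f by (simp add: norm_mult)
  qed (use g in auto)
  have i1: "integrable (lborel \<Otimes>\<^sub>M lborel) (case_prod h1)"
    by (rule Bochner_Integration.integrable_bound[OF fg]) (auto simp: h1_def[abs_def] intro!: AE_I2)
  have i2: "integrable (lborel \<Otimes>\<^sub>M lborel) (case_prod h2)"
    by (rule Bochner_Integration.integrable_bound[OF fg]) (auto simp: h2_def[abs_def] intro!: AE_I2)
  have e1: "?L1 = (\<integral>t. (\<integral>s. h1 t s \<partial>lborel) \<partial>lborel)"
    by (subst integral_mult_right_zero [symmetric], intro Bochner_Integration.integral_cong refl)
       (auto simp: h1_def)
  have "?L2 = (\<integral>s. (\<integral>t. h2 t s \<partial>lborel) \<partial>lborel)"
    by (subst integral_mult_left_zero [symmetric], intro Bochner_Integration.integral_cong refl)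
       (auto simp: h2_def)
  also have "\<dots> = (\<integral>t. (\<integral>s. h2 t s \<partial>lborel) \<partial>lborel)"
    by (rule lborel_pair.Fubini_integral[OF i2])
  finally have "?L1 + ?L2 = (\<integral>t. (\<integral>s. h1 t s \<partial>lborel) \<partial>lborel) + (\<integral>t. (\<integral>s. h2 t s \<partial>lborel) \<partial>lborel)"
    unfolding e1 by simp
  also have "\<dots> = (\<integral>p. case_prod h1 p \<partial>(lborel \<Otimes>\<^sub>M lborel)) + (\<integral>p. case_prod h2 p \<partial>(lborel \<Otimes>\<^sub>M lborel))"
    using lborel_pair.integral_fst'[OF i1] lborel_pair.integral_fst'[OF i2] by simp
  also have "\<dots> = (\<integral>p. case_prod h1 p + case_prod h2 p \<partial>(lborel \<Otimes>\<^sub>M lborel))"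
    using i1 i2 by simp
  also have "\<dots> = (\<integral>t. (\<integral>s. h1 t s + h2 t s \<partial>lborel) \<partial>lborel)"
    using lborel_pair.integral_fst'[OF Bochner_Integration.integrable_add[OF i1 i2]] by simp
  also have "\<dots> = (\<integral>t. (\<integral>s. f t * g s \<partial>lborel) \<partial>lborel)"
  proof (rule Bochner_Integration.integral_cong[OF refl], rule integral_cong_AE)
    show "AE s in lborel. h1 t s + h2 t s = f t * g s" for t
      using AE_lborel_singleton[of t] by eventually_elim (auto simp: h1_def h2_def)
  qed (auto simp: h1_def h2_def)
  finally show ?thesis by simp
qed

lemma integrable_I01_mult_continuous:
  fixes f F :: "real \<Rightarrow> complex"
  assumes F: "continuous_on {0..1} F" and f: "integrable I01 f"
  shows "integrable I01 (\<lambda>x. F x * f x)"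
proof -
  have "bounded (F ` {0..1})" using F by (intro compact_imp_bounded compact_continuous_image) auto
  then obtain B where B: "\<And>x. x \<in> {0..1} \<Longrightarrow> cmod (F x) \<le> B" unfolding bounded_iff by (meson imageI)
  note [measurable] = borel_measurable_I01_continuous[OF F] borel_measurable_integrable[OF f]
  show ?thesis
  proof (rule Bochner_Integration.integrable_bound)
    show "integrable I01 (\<lambda>x. complex_of_real B * f x)" using f by simp
    show "AE x in I01. cmod (F x * f x) \<le> cmod (complex_of_real B * f x)"
    proof (intro AE_I2)
      fix x assume "x \<in> space I01"
      then have "cmod (F x) \<le> \<bar>B\<bar>" using B[of x] by (simp add: space_I01)
      then show "cmod (F x * f x) \<le> cmod (complex_of_real B * f x)"
        by (simp add: norm_mult mult_right_mono)
    qed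
  qed measurable
qed

text \<open>The product rule, hence integration by parts. The increments of \<open>F\<close> and
  \<open>G\<close> from 0 are inner integrals over \<open>{..t}\<close>, so the claim reduces to
  \<open>integral_by_parts_lborel\<close>.\<close>

lemma AC_mult:
  assumes F: "AC F f" and G: "AC G g"
  shows "AC (\<lambda>x. F x * G x) (\<lambda>x. f x * G x + F x * g x)"
proof -
  have 1: "integrable I01 (\<lambda>x. f x * G x)"
    using integrable_I01_mult_continuous[OF AC_continuous[OF G] AC_integrable[OF F]] by (simp add: mult.commute)
  have 2: "integrable I01 (\<lambda>x. F x * g x)"
    by (rule integrable_I01_mult_continuous[OF AC_continuous[OF F] AC_integrable[OF G]])
  have "F x * G x = F 0 * G 0 + primitive (\<lambda>x. f x * G x + F x * g x) x" if x: "x \<in> {0..1}" for x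
  proof -
    \<comment> \<open>Cutting both derivatives off outside [0,x] makes the identity over the whole
      line applicable.\<close>
    define f' where "f' t = indicator {0..x} t *\<^sub>R f t" for t
    define g' where "g' t = indicator {0..x} t *\<^sub>R g t" for t
    have f'i: "integrable lborel f'" and g'i: "integrable lborel g'"
      using set_integrable_prefix[OF AC_integrable[OF F] x] set_integrable_prefix[OF AC_integrable[OF G] x]
      by (simp_all add: f'_def[abs_def] g'_def[abs_def] set_integrable_def)
    have Ff: "F t = F 0 + (\<integral>s. indicator {..t} s *\<^sub>R f' s \<partial>lborel)" if "t \<in> {0..x}" for t
      using AC_eq[OF F, of t] that x unfolding primitive_def set_lebesgue_integral_def f'_def
      by (auto intro!: Bochner_Integration.integral_cong simp: indicator_def)
    have Gg: "G t = G 0 + (\<integral>s. indicator {..t} s *\<^sub>R g' s \<partial>lborel)" if "t \<in> {0..x}" for t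
      using AC_eq[OF G, of t] that x unfolding primitive_def set_lebesgue_integral_def g'_def
      by (auto intro!: Bochner_Integration.integral_cong simp: indicator_def)
    have Fx: "F x = F 0 + (\<integral>t. f' t \<partial>lborel)" and Gx: "G x = G 0 + (\<integral>t. g' t \<partial>lborel)"
      using AC_eq[OF F x] AC_eq[OF G x] by (simp_all add: primitive_def set_lebesgue_integral_def f'_def g'_def)
    have s1: "integrable lborel (\<lambda>t. indicator {0..x} t *\<^sub>R (f t * G t))"
     and s2: "integrable lborel (\<lambda>t. indicator {0..x} t *\<^sub>R (F t * g t))"
      using set_integrable_prefix[OF 1 x] set_integrable_prefix[OF 2 x] by (simp_all add: set_integrable_def)
    have e1: "indicator {0..x} t *\<^sub>R (f t * G t) = f' t * G 0 + f' t * (\<integral>s. indicator {..t} s *\<^sub>R g' s \<partial>lborel)" for t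
    proof (cases "t \<in> {0..x}")
      case True
      show ?thesis by (subst Gg[OF True]) (use True in \<open>simp add: f'_def distrib_left\<close>)
    qed (simp add: f'_def)
    have e2: "indicator {0..x} t *\<^sub>R (F t * g t) = F 0 * g' t + (\<integral>s. indicator {..t} s *\<^sub>R f' s \<partial>lborel) * g' t" for t
    proof (cases "t \<in> {0..x}")
      case True
      show ?thesis by (subst Ff[OF True]) (use True in \<open>simp add: g'_def distrib_right\<close>)
    qed (simp add: g'_def)
    \<comment> \<open>By \<open>e1\<close> this function differs from an integrable one by a
      multiple of \<open>f'\<close>; likewise \<open>i2\<close> by \<open>e2\<close>.\<close>
    have i1: "integrable lborel (\<lambda>t. f' t * (\<integral>s. indicator {..t} s *\<^sub>R g' s \<partial>lborel))"
      using Bochner_Integration.integrable_diff[OF s1 integrable_mult_left[OF f'i, of "G 0"]] by (simp add: e1)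
    have i2: "integrable lborel (\<lambda>t. (\<integral>s. indicator {..t} s *\<^sub>R f' s \<partial>lborel) * g' t)"
      using Bochner_Integration.integrable_diff[OF s2 integrable_mult_right[OF g'i, of "F 0"]] by (simp add: e2)
    have "primitive (\<lambda>x. f x * G x + F x * g x) x
        = (\<integral>t. indicator {0..x} t *\<^sub>R (f t * G t) \<partial>lborel) + (\<integral>t. indicator {0..x} t *\<^sub>R (F t * g t) \<partial>lborel)"
      unfolding primitive_def set_lebesgue_integral_def
      by (subst Bochner_Integration.integral_add[OF s1 s2, symmetric]) (simp add: scaleR_add_right)
    also have "\<dots> = (\<integral>t. f' t \<partial>lborel) * G 0 + F 0 * (\<integral>t. g' t \<partial>lborel) + (\<integral>t. f' t \<partial>lborel) * (\<integral>t. g' t \<partial>lborel)"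
      unfolding e1 e2 integral_by_parts_lborel[OF f'i g'i, symmetric] 
      using f'i g'i i1 i2 by simp
    also have "F 0 * G 0 + \<dots> = F x * G x"
      unfolding Fx Gx by (simp add: algebra_simps)
    finally show ?thesis by simp
  qed
  with Bochner_Integration.integrable_add[OF 1 2] show ?thesis unfolding AC_def by blast
qed

text \<open>What \<open>H2_rep\<close> leaves implicit is the integrability of \<open>h1\<close>: as
  a primitive of \<open>h2\<close> it is continuous on [0,1].\<close>

lemma H2_rep_AC: "H2_rep h h1 h2 \<longleftrightarrow> h2 \<in> L2 \<and> AC h1 h2 \<and> AC h h1"
proof -
  have "integrable I01 h1" if "h2 \<in> L2" "\<forall>x\<in>{0..1}. h1 x = h1 0 + primitive h2 x"
  proof (intro integrable_I01_continuous AC_continuous[where f=h2])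
    show "AC h1 h2" unfolding AC_def using L2_integrable[OF that(1)] that(2) by blast
  qed
  then show ?thesis using L2_integrable unfolding H2_rep_def AC_def primitive_def[symmetric] by blast
qed

section \<open>The Lyapunov form\<close>

lemma L2norm_le_bound:
  assumes "f \<in> borel_measurable I01" "\<And>x. x \<in> {0..1} \<Longrightarrow> cmod (f x) \<le> B" "0 \<le> B"
  shows "L2norm f \<le> B"
proof -
  have "(L2norm f)\<^sup>2 \<le> (\<integral>x. B\<^sup>2 \<partial>I01)"
    unfolding L2norm_power2
    by (rule integral_mono)
       (use assms L2_bounded[OF assms(1,2)] in \<open>auto simp: space_I01 L2_iff intro: power_mono\<close>)
  also have "\<dots> = B\<^sup>2" by (simp add: space_I01 measure_I01)
  finally show ?thesis using assms(3) by (rule power2_le_imp_le)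
qed

text \<open>Cauchy-Schwarz against the constant 1. The pointwise bound makes
  \<open>weighted_tail\<close> a bounded operator; its constant 2 comes from the two evaluations at
  \<open>x\<close> and at 1.\<close>

lemma norm_primitive_le:
  assumes "f \<in> L2" "x \<in> {0..1}" shows "cmod (primitive f x) \<le> L2norm f"
proof -
  have i: "set_integrable lborel {0..1} (\<lambda>t. cmod (f t))"
    using L2_integrable[OF assms(1)] by (simp flip: integrable_I01)
  have "cmod (primitive f x) \<le> (LINT t:{0..x}|lborel. cmod (f t))"
    unfolding primitive_def set_lebesgue_integral_def
    by (rule order_trans[OF integral_norm_bound]) (simp add: norm_scaleR)
  also have "\<dots> \<le> (LINT t:{0..1}|lborel. cmod (f t))"
    unfolding set_lebesgue_integral_def
  proof (rule integral_mono)
    show "integrable lborel (\<lambda>t. indicator {0..x} t *\<^sub>R cmod (f t))"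
      using set_integrable_subset[OF i, of "{0..x}"] assms(2) by (auto simp: set_integrable_def)
  qed (use assms(2) i in \<open>auto simp: set_integrable_def indicator_def\<close>)
  also have "\<dots> = (\<integral>t. cmod (f t) * cmod 1 \<partial>I01)"
    by (simp add: integral_I01)
  also have "\<dots> \<le> L2norm f * L2norm (\<lambda>_. 1)"
    using assms(1) L2_bounded[of "\<lambda>_. 1" 1] by (intro integral_mult_le_L2norm) auto
  also have "\<dots> \<le> L2norm f"
    using L2norm_le_bound[of "\<lambda>_. 1" 1] by (simp add: mult_left_le)
  finally show ?thesis .
qed

lemma primitive_cong_AE:
  assumes "f \<in> L2" "g \<in> L2" "L2eq f g" "x \<in> {0..1}" shows "primitive f x = primitive g x"
  unfolding primitive_def set_lebesgue_integral_def
proof (rule integral_cong_AE)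
  show "AE t in lborel. indicator {0..x} t *\<^sub>R f t = indicator {0..x} t *\<^sub>R g t"
    using assms(3) unfolding L2eq_def by eventually_elim (use assms(4) in \<open>auto simp: indicator_def\<close>)
  show "(\<lambda>t. indicator {0..x} t *\<^sub>R f t) \<in> borel_measurable lborel"
    using set_integrable_prefix[OF L2_integrable[OF assms(1)] assms(4)] by (auto simp: set_integrable_def)
  show "(\<lambda>t. indicator {0..x} t *\<^sub>R g t) \<in> borel_measurable lborel"
    using set_integrable_prefix[OF L2_integrable[OF assms(2)] assms(4)] by (auto simp: set_integrable_def)
qed

text \<open>This is x z(x) for the z of the overview. The weight vanishes at 0 and the tail at 1, so
  no boundary terms survive when it is integrated by parts against the second derivative.\<close>

definition weighted_tail :: "(real \<Rightarrow> complex) \<Rightarrow> real \<Rightarrow> complex" where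
  "weighted_tail f x = complex_of_real x * (primitive f x - primitive f 1)"

lemma weighted_tail_measurable: "f \<in> L2 \<Longrightarrow> weighted_tail f \<in> borel_measurable I01"
  unfolding weighted_tail_def by (intro borel_measurable_I01_continuous continuous_intros continuous_on_primitive L2_integrable)

lemma norm_weighted_tail_le:
  assumes "f \<in> L2" "x \<in> {0..1}" shows "cmod (weighted_tail f x) \<le> 2 * L2norm f"
proof -
  have "cmod (primitive f x - primitive f 1) \<le> L2norm f + L2norm f"
    using norm_primitive_le[OF assms] norm_primitive_le[OF assms(1), of 1] norm_triangle_ineq4[of "primitive f x" "primitive f 1"] by simp
  moreover have "cmod (weighted_tail f x) \<le> cmod (primitive f x - primitive f 1)"
    using assms(2) by (simp add: weighted_tail_def norm_mult mult_left_le_one_le)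
  ultimately show ?thesis by simp
qed

lemma weighted_tail_L2: "f \<in> L2 \<Longrightarrow> weighted_tail f \<in> L2"
  by (rule L2_bounded[OF weighted_tail_measurable norm_weighted_tail_le])

lemma L2norm_weighted_tail: "f \<in> L2 \<Longrightarrow> L2norm (weighted_tail f) \<le> 2 * L2norm f"
  by (rule L2norm_le_bound[OF weighted_tail_measurable norm_weighted_tail_le]) auto

lemma weighted_tail_lincomb:
  assumes "f \<in> L2" "g \<in> L2" "x \<in> {0..1}"
  shows "weighted_tail (\<lambda>x. a * f x + b * g x) x = a * weighted_tail f x + b * weighted_tail g x"
  using primitive_add[OF L2_integrable[OF assms(1)] L2_integrable[OF assms(2)] assms(3), of a b]
    primitive_add[OF L2_integrable[OF assms(1)] L2_integrable[OF assms(2)], of 1 a b]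
  by (simp add: weighted_tail_def algebra_simps)

text \<open>The correction is symmetrised, which makes \<open>lyap\<close> a symmetric real bilinear
  form; on the diagonal it is the squared norm minus
  \<open>\<epsilon> * Im (ip (weighted_tail f) f)\<close>.\<close>

definition lyap :: "real \<Rightarrow> (real \<Rightarrow> complex) \<Rightarrow> (real \<Rightarrow> complex) \<Rightarrow> real" where
  "lyap \<epsilon> f g = Re (ip f g) - \<epsilon> / 2 * (Im (ip (weighted_tail f) g) + Im (ip (weighted_tail g) f))"

lemma lyap_commute: "lyap \<epsilon> f g = lyap \<epsilon> g f"
  using arg_cong[OF ip_cnj[of f g], of Re] by (simp add: lyap_def)

lemma ip_weighted_tail_lincomb:
  assumes "f \<in> L2" "g \<in> L2" "h \<in> L2"
  shows "ip (weighted_tail (\<lambda>x. a * f x + b * g x)) h = a * ip (weighted_tail f) h + b * ip (weighted_tail g) h"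
proof -
  have "ip (weighted_tail (\<lambda>x. a * f x + b * g x)) h = ip (\<lambda>x. a * weighted_tail f x + b * weighted_tail g x) h"
    unfolding ip_def by (rule Bochner_Integration.integral_cong) (simp_all add: space_I01 weighted_tail_lincomb[OF assms(1,2)])
  then show ?thesis using assms by (simp add: ip_lincomb_left weighted_tail_L2)
qed

lemma lyap_lincomb_right:
  assumes "f \<in> L2" "g \<in> L2" "h \<in> L2"
  shows "lyap \<epsilon> h (\<lambda>x. complex_of_real a * f x + complex_of_real b * g x) = a * lyap \<epsilon> h f + b * lyap \<epsilon> h g"
  using assms by (simp add: lyap_def ip_weighted_tail_lincomb ip_lincomb_right weighted_tail_L2 algebra_simps)

lemma lyap_diff_right:
  assumes "f \<in> L2" "g \<in> L2" "h \<in> L2"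
  shows "lyap \<epsilon> h (\<lambda>x. f x - g x) = lyap \<epsilon> h f - lyap \<epsilon> h g"
  using lyap_lincomb_right[OF assms, of \<epsilon> 1 "-1"] by simp

lemma lyap_add_self:
  assumes "f \<in> L2" "g \<in> L2"
  shows "lyap \<epsilon> (\<lambda>x. f x + g x) (\<lambda>x. f x + g x) = lyap \<epsilon> f f + 2 * lyap \<epsilon> f g + lyap \<epsilon> g g"
proof -
  have r: "lyap \<epsilon> h (\<lambda>x. f x + g x) = lyap \<epsilon> h f + lyap \<epsilon> h g" if "h \<in> L2" for h
    using lyap_lincomb_right[OF assms that, of \<epsilon> 1 1] by simp
  show ?thesis
    using r[OF L2_add[OF assms]] r[OF assms(1)] r[OF assms(2)] 
      lyap_commute[of \<epsilon> "\<lambda>x. f x + g x" f] lyap_commute[of \<epsilon> "\<lambda>x. f x + g x" g] lyap_commute[of \<epsilon> f g] by simp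
qed

lemma ip_weighted_tail_bound:
  assumes "f \<in> L2" "g \<in> L2" shows "cmod (ip (weighted_tail f) g) \<le> 2 * L2norm f * L2norm g"
  using ip_bound[OF weighted_tail_L2[OF assms(1)] assms(2)] mult_right_mono[OF L2norm_weighted_tail[OF assms(1)], of "L2norm g"] by simp

text \<open>The correction contributes at most half of the product of the norms; the resulting
  factor 3/2 is rounded up to 2.\<close>

lemma lyap_bound:
  assumes "f \<in> L2" "g \<in> L2" "0 \<le> \<epsilon>" "\<epsilon> \<le> 1/4"
  shows "\<bar>lyap \<epsilon> f g\<bar> \<le> 2 * L2norm f * L2norm g"
proof -
  have "\<bar>Im (ip (weighted_tail f) g) + Im (ip (weighted_tail g) f)\<bar> \<le> 4 * (L2norm f * L2norm g)"
    using abs_Im_le_cmod[of "ip (weighted_tail f) g"] ip_weighted_tail_bound[OF assms(1,2)] 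
      abs_Im_le_cmod[of "ip (weighted_tail g) f"] ip_weighted_tail_bound[OF assms(2,1)] by (simp add: mult_ac)
  then have "\<bar>\<epsilon> / 2 * (Im (ip (weighted_tail f) g) + Im (ip (weighted_tail g) f))\<bar> \<le> (1/8) * (4 * (L2norm f * L2norm g))"
    unfolding abs_mult using assms(3,4) by (intro mult_mono) auto
  moreover have "\<bar>Re (ip f g)\<bar> \<le> L2norm f * L2norm g"
    using abs_Re_le_cmod[of "ip f g"] ip_bound[OF assms(1,2)] by simp
  moreover have "0 \<le> L2norm f * L2norm g" by simp
  ultimately show ?thesis unfolding lyap_def by linarith
qed

text \<open>The correction takes away at most half of the squared norm.\<close>

lemma lyap_lower:
  assumes "f \<in> L2" "0 \<le> \<epsilon>" "\<epsilon> \<le> 1/4"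
  shows "(L2norm f)\<^sup>2 \<le> 2 * lyap \<epsilon> f f"
proof -
  have "\<bar>Im (ip (weighted_tail f) f)\<bar> \<le> 2 * (L2norm f)\<^sup>2"
    using abs_Im_le_cmod[of "ip (weighted_tail f) f"] ip_weighted_tail_bound[OF assms(1,1)] by (simp add: power2_eq_square)
  then have "\<bar>\<epsilon> * Im (ip (weighted_tail f) f)\<bar> \<le> (1/4) * (2 * (L2norm f)\<^sup>2)"
    unfolding abs_mult using assms(2,3) by (intro mult_mono) auto
  then show ?thesis by (simp add: lyap_def ip_self)
qed

lemma weighted_tail_cong:
  assumes "f \<in> L2" "f' \<in> L2" "L2eq f f'" shows "L2eq (weighted_tail f) (weighted_tail f')"
proof -
  have "weighted_tail f x = weighted_tail f' x" if "x \<in> {0..1}" for x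
    using primitive_cong_AE[OF assms that] primitive_cong_AE[OF assms, of 1] by (simp add: weighted_tail_def)
  then show ?thesis by (simp add: L2eq_def)
qed

text \<open>\<open>Agraph\<close> gives \<open>f\<close> and \<open>u\<close> only up to null sets,
  while the dissipation identity concerns the regular representative; this lemma transfers the
  values.\<close>

lemma lyap_cong:
  assumes "f \<in> L2" "f' \<in> L2" "L2eq f f'" "g \<in> L2" "g' \<in> L2" "L2eq g g'"
  shows "lyap \<epsilon> f g = lyap \<epsilon> f' g'"
  using ip_cong[OF assms] ip_cong[OF weighted_tail_L2[OF assms(1)] weighted_tail_L2[OF assms(2)] weighted_tail_cong[OF assms(1,2,3)] assms(4,5,6)]
    ip_cong[OF weighted_tail_L2[OF assms(4)] weighted_tail_L2[OF assms(5)] weighted_tail_cong[OF assms(4,5,6)] assms(1,2,3)]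
  by (simp add: lyap_def)

text \<open>Both quadratic forms inside \<open>lyap\<close> are invariant under rotating the phase
  of \<open>f\<close>, so the velocity of this rotation is orthogonal to \<open>f\<close>. This
  makes the resolvent bound uniform in \<open>\<omega>\<close>.\<close>

lemma lyap_imaginary:
  assumes "f \<in> L2"
  shows "lyap \<epsilon> f (\<lambda>x. \<i> * complex_of_real \<omega> * f x) = 0"
  using ip_lincomb_right[OF assms assms assms, of "\<i> * complex_of_real \<omega>" 0]
    ip_lincomb_right[OF assms assms weighted_tail_L2[OF assms], of "\<i> * complex_of_real \<omega>" 0]
    ip_weighted_tail_lincomb[OF assms assms assms, of "\<i> * complex_of_real \<omega>" 0]
  by (simp add: lyap_def ip_self)

section \<open>Dissipation along the generator\<close>

lemma AC_of_real: "AC complex_of_real (\<lambda>_. 1)"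
  by (rule AC_C1) (auto intro!: continuous_intros derivative_eq_intros simp: has_vector_derivative_def scaleR_conv_of_real fun_eq_iff)

text \<open>Each identity is the fundamental theorem for one product of absolutely continuous functions:
  \<open>h' cnj h\<close>, \<open>x h cnj h\<close>, \<open>x z cnj h'\<close> and \<open>z cnj h\<close>, where \<open>z = - \<integral>\<^sub>x\<^sup>1 h\<close>.\<close>

lemma lyap_dissipation_identity:
  assumes H: "H2_rep h h1 h2" and h0: "h 0 = 0" and h11: "h1 1 = - \<i> * complex_of_real k * h 1"
  shows "2 * lyap \<epsilon> h (\<lambda>x. - \<i> * h2 x) = - 2 * k * (cmod (h 1))\<^sup>2 
     - \<epsilon> * (2 * (L2norm h)\<^sup>2 - (cmod (h 1))\<^sup>2 + k * Im (h 1 * ip complex_of_real h))"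
proof -
  from H have h2: "h2 \<in> L2" and A1: "AC h1 h2" and A: "AC h h1" by (auto simp: H2_rep_AC)
  define z where "z x = primitive h x - primitive h 1" for x
  define u where "u x = - \<i> * h2 x" for x
  have u: "u \<in> L2" unfolding u_def by (rule L2_cmult[OF h2])
  have Z: "AC z h" unfolding z_def 
    using AC_primitive[OF integrable_I01_continuous[OF AC_continuous[OF A]], of "- primitive h 1"] by simp
  note c = AC_continuous[OF A] AC_continuous[OF A1] AC_continuous[OF Z]
  have hL2: "h \<in> L2" and h1L2: "h1 \<in> L2" and zL2: "z \<in> L2"
    using c by (auto intro: L2_continuous)
  have xhL2: "(\<lambda>x. complex_of_real x * h x) \<in> L2" and xzL2: "(\<lambda>x. complex_of_real x * z x) \<in> L2"
    and xh1L2: "(\<lambda>x. complex_of_real x * h1 x) \<in> L2" and xL2: "complex_of_real \<in> L2"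
    using c by (auto intro!: L2_continuous continuous_intros)
  note ints = ip_integrable[OF h2 hL2] ip_integrable[OF h1L2 h1L2] ip_integrable[OF hL2 hL2] ip_integrable[OF xh1L2 hL2]
     ip_integrable[OF xhL2 h1L2] ip_integrable[OF zL2 h1L2] ip_integrable[OF xzL2 h2]
  have 1: "ip h2 h + ip h1 h1 = - \<i> * complex_of_real (k * (cmod (h 1))\<^sup>2)"
    using AC_integral[OF AC_mult[OF A1 AC_cnj[OF A]]] ints h0 h11 complex_norm_square[of "h 1"]
    by (simp add: ip_def mult_ac)
  have 2: "ip h h + (ip (\<lambda>x. complex_of_real x * h1 x) h + ip (\<lambda>x. complex_of_real x * h x) h1)
     = complex_of_real ((cmod (h 1))\<^sup>2)"
    using AC_integral[OF AC_mult[OF AC_of_real AC_mult[OF A AC_cnj[OF A]]]] ints complex_norm_square[of "h 1"]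
    by (simp add: ip_def distrib_left mult.assoc)
  have 3: "ip z h1 + (ip (\<lambda>x. complex_of_real x * h x) h1 + ip (\<lambda>x. complex_of_real x * z x) h2) = 0"
    using AC_integral[OF AC_mult[OF AC_of_real AC_mult[OF Z AC_cnj[OF A1]]]] ints
    by (simp add: ip_def distrib_left mult.assoc z_def[of 1])
  have 4: "ip h h + ip z h1 = 0"
    using AC_integral[OF AC_mult[OF Z AC_cnj[OF A]]] ints h0
    by (simp add: ip_def z_def[of 1])
  have Kh: "weighted_tail h = (\<lambda>x. complex_of_real x * z x)" by (simp add: weighted_tail_def z_def fun_eq_iff)
  have primitive_u: "primitive u x = - \<i> * (h1 x - h1 0)" if "x \<in> {0..1}" for x
    using primitive_add[OF L2_integrable[OF h2] L2_integrable[OF h2] that, of "-\<i>" 0] AC_eq[OF A1 that]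
    unfolding u_def by simp
  \<comment> \<open>The boundary condition at 1 turns \<open>h1 1\<close> into a multiple of
    \<open>h 1\<close>.\<close>
  have primitive_u1: "primitive u 1 = \<i> * h1 0 - complex_of_real k * h 1"
    using primitive_u[of 1] h11 by (simp add: algebra_simps)
  \<comment> \<open>The unknown \<open>h1 0\<close> cancels between the two primitives; besides the
    weighted -i z'' only the trace \<open>h 1\<close> remains.\<close>
  have Ku: "weighted_tail u x = (- \<i>) * (complex_of_real x * h1 x) + (complex_of_real k * h 1) * complex_of_real x" 
    if "x \<in> {0..1}" for x
    unfolding weighted_tail_def primitive_u[OF that] primitive_u1 by (simp add: algebra_simps)
  have "ip (weighted_tail u) h = ip (\<lambda>x. (- \<i>) * (complex_of_real x * h1 x) + (complex_of_real k * h 1) * complex_of_real x) h"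
    unfolding ip_def by (rule Bochner_Integration.integral_cong) (simp_all add: space_I01 Ku)
  also have "\<dots> = (- \<i>) * ip (\<lambda>x. complex_of_real x * h1 x) h + (complex_of_real k * h 1) * ip complex_of_real h"
    by (rule ip_lincomb_left[OF xh1L2 xL2 hL2])
  finally have "ip (weighted_tail u) h = (- \<i>) * ip (\<lambda>x. complex_of_real x * h1 x) h + complex_of_real k * (h 1 * ip complex_of_real h)"
    by (simp add: mult.assoc)
  then have 5: "Im (ip (weighted_tail u) h) = - Re (ip (\<lambda>x. complex_of_real x * h1 x) h) + k * Im (h 1 * ip complex_of_real h)"
    by (simp del: times_complex.sel(2) add: times_complex.sel(2)[of "complex_of_real k"] times_complex.sel(2)[of "- \<i>"])
  have 6: "Im (ip (weighted_tail h) u) = Re (ip (\<lambda>x. complex_of_real x * z x) h2)"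
    using ip_lincomb_right[OF h2 h2 xzL2, of "-\<i>" 0] unfolding u_def Kh by simp
  have "ip u h = - \<i> * ip h2 h"
    using ip_lincomb_left[OF h2 h2 hL2, of "-\<i>" 0] unfolding u_def by simp
  then have 7: "Re (ip h u) = Im (ip h2 h)"
    using arg_cong[OF ip_cnj[of u h], of Re] by simp
  have "Im (ip h2 h) = - k * (cmod (h 1))\<^sup>2" using arg_cong[OF 1, of Im] by (simp add: ip_self)
  moreover have "(L2norm h)\<^sup>2 + (Re (ip (\<lambda>x. complex_of_real x * h1 x) h) + Re (ip (\<lambda>x. complex_of_real x * h x) h1)) = (cmod (h 1))\<^sup>2"
    using arg_cong[OF 2, of Re] by (simp add: ip_self)
  moreover have "Re (ip (\<lambda>x. complex_of_real x * z x) h2) = (L2norm h)\<^sup>2 - Re (ip (\<lambda>x. complex_of_real x * h x) h1)"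
    using arg_cong[OF 3, of Re] arg_cong[OF 4, of Re] by (simp add: ip_self)
  \<comment> \<open>The mixed terms \<open>Re <x h', h>\<close> and \<open>Re <x h, h'>\<close> add
    up to |h(1)|^2 minus the squared norm. Subtracting this sum is where the second copy of the
    squared norm comes from.\<close>
  ultimately have sums: "Im (ip (weighted_tail h) u) + Im (ip (weighted_tail u) h) = 2 * (L2norm h)\<^sup>2 - (cmod (h 1))\<^sup>2 + k * Im (h 1 * ip complex_of_real h)"
    "Re (ip h u) = - k * (cmod (h 1))\<^sup>2"
    using 5 6 7 by linarith+
  have "2 * lyap \<epsilon> h u = 2 * Re (ip h u) - \<epsilon> * (Im (ip (weighted_tail h) u) + Im (ip (weighted_tail u) h))"
    by (simp add: lyap_def)
  also have "\<dots> = - 2 * k * (cmod (h 1))\<^sup>2 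
     - \<epsilon> * (2 * (L2norm h)\<^sup>2 - (cmod (h 1))\<^sup>2 + k * Im (h 1 * ip complex_of_real h))"
    unfolding sums by (simp del: times_complex.sel)
  finally show ?thesis unfolding u_def[abs_def] .
qed

text \<open>The bound \<open>1/4\<close> keeps \<open>lyap\<close> equivalent to the norm; the other one lets the boundary
  dissipation absorb the cross term \<open>k |f(1)| \<parallel>f\<parallel> \<le> \<parallel>f\<parallel>\<^sup>2 + k\<^sup>2/4 |f(1)|\<^sup>2\<close>.\<close>

definition lyap_eps :: "real \<Rightarrow> real" where "lyap_eps k = min (1/4) (2 * k / (1 + k\<^sup>2 / 4))"

lemma lyap_eps_bounds:
  assumes "k > 0" shows "0 < lyap_eps k" "lyap_eps k \<le> 1/4" "lyap_eps k * (1 + k\<^sup>2 / 4) \<le> 2 * k"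
proof -
  have p: "0 < 1 + k\<^sup>2 / 4" by (simp add: add_pos_nonneg)
  then show "0 < lyap_eps k" "lyap_eps k \<le> 1/4" using assms by (simp_all add: lyap_eps_def)
  have "lyap_eps k \<le> 2 * k / (1 + k\<^sup>2 / 4)" by (simp add: lyap_eps_def)
  with p show "lyap_eps k * (1 + k\<^sup>2 / 4) \<le> 2 * k" by (simp add: pos_le_divide_eq)
qed

lemma Agraph_L2: "Agraph k f u \<Longrightarrow> f \<in> L2" "Agraph k f u \<Longrightarrow> u \<in> L2"
  by (simp_all add: Agraph_def)

lemma lyap_dissipative:
  assumes "k > 0" "Agraph k f u"
  shows "2 * lyap (lyap_eps k) f u \<le> - lyap_eps k * (L2norm f)\<^sup>2"
proof -
  from assms(2) obtain h h1 h2 where H: "H2_rep h h1 h2" and fh: "L2eq f h" and h0: "h 0 = 0" 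
    and h11: "h1 1 = - \<i> * complex_of_real k * h 1" and u2: "L2eq u (\<lambda>x. - \<i> * h2 x)"
    by (auto simp: Agraph_def)
  note fu = Agraph_L2[OF assms(2)]
  have hL2: "h \<in> L2" and h2: "(\<lambda>x. - \<i> * h2 x) \<in> L2"
    using H by (auto simp only: H2_rep_AC intro!: L2_continuous[of h] AC_continuous[of h h1] L2_cmult)
  define p N q where "p = cmod (h 1)" "N = L2norm h" "q = Im (h 1 * ip complex_of_real h)"
  have "L2norm complex_of_real \<le> 1"
    by (rule L2norm_le_bound) (auto intro!: borel_measurable_I01_continuous continuous_intros)
  then have "cmod (ip complex_of_real h) \<le> 1 * N"
    unfolding p_N_q_def
    by (intro order_trans[OF ip_bound[OF _ hL2]] mult_right_mono) (auto intro!: L2_continuous continuous_intros)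
  then have "cmod (h 1 * ip complex_of_real h) \<le> p * N"
    unfolding norm_mult p_N_q_def by (intro mult_left_mono) auto
  then have "\<bar>q\<bar> \<le> p * N" using abs_Im_le_cmod[of "h 1 * ip complex_of_real h"] by (simp add: p_N_q_def)
  then have "k * \<bar>q\<bar> \<le> k * (p * N)" using assms(1) by simp
  moreover have "k * (p * N) \<le> N\<^sup>2 + k\<^sup>2 / 4 * p\<^sup>2"
    using zero_le_power2[of "N - k * p / 2"] by (simp add: power2_eq_square algebra_simps)
  moreover have "- (k * q) \<le> k * \<bar>q\<bar>" using assms(1) by (simp add: abs_if)
  ultimately have "- (k * q) \<le> N\<^sup>2 + k\<^sup>2 / 4 * p\<^sup>2" by linarith
  then have "lyap_eps k * - (k * q) \<le> lyap_eps k * (N\<^sup>2 + k\<^sup>2 / 4 * p\<^sup>2)"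
    using lyap_eps_bounds(1)[OF assms(1)] by (intro mult_left_mono) auto
  \<comment> \<open>The summand 1 pays for the boundary term of the multiplier identity,
    \<open>k\<^sup>2 / 4\<close> for the cross term. Of the two copies of \<open>N\<^sup>2\<close>
    one is spent on the cross term and one is left over.\<close>
  moreover have "lyap_eps k * (1 + k\<^sup>2 / 4) * p\<^sup>2 \<le> 2 * k * p\<^sup>2"
    using lyap_eps_bounds(3)[OF assms(1)] by (intro mult_right_mono) auto
  ultimately have "- 2 * k * p\<^sup>2 - lyap_eps k * (2 * N\<^sup>2 - p\<^sup>2 + k * q) \<le> - lyap_eps k * N\<^sup>2"
    by (simp add: algebra_simps)
  moreover have "2 * lyap (lyap_eps k) f u = - 2 * k * p\<^sup>2 - lyap_eps k * (2 * N\<^sup>2 - p\<^sup>2 + k * q)"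
    unfolding lyap_cong[OF fu(1) hL2 fh fu(2) h2 u2] lyap_dissipation_identity[OF H h0 h11] p_N_q_def ..
  ultimately show ?thesis using L2norm_cong[OF fu(1) hL2 fh] by (simp add: p_N_q_def)
qed

text \<open>Pair the resolvent equation with \<open>f\<close> in the form \<open>lyap\<close>: the
  term with \<open>\<omega>\<close> drops out, dissipativity bounds the left side below by the
  squared norm of \<open>f\<close>, and \<open>lyap_bound\<close> bounds the right side.\<close>

lemma resolvent_bound:
  assumes k: "k > 0" and A: "Agraph k f u" and g: "g \<in> L2" and e: "L2eq (\<lambda>x. \<i> * complex_of_real \<omega> * f x - u x) g"
  shows "L2norm f \<le> 4 / lyap_eps k * L2norm g"
proof (cases "L2norm f = 0")
  case True then show ?thesis using lyap_eps_bounds(1)[OF k] by simp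
next
  case False
  then have pos: "L2norm f > 0" using L2norm_nonneg[of f] by linarith
  note fu = Agraph_L2[OF A]
  have w: "(\<lambda>x. \<i> * complex_of_real \<omega> * f x) \<in> L2" by (rule L2_cmult[OF fu(1)])
  have "lyap (lyap_eps k) f g = lyap (lyap_eps k) f (\<lambda>x. \<i> * complex_of_real \<omega> * f x - u x)"
    by (rule lyap_cong[OF fu(1) fu(1) _ g L2_diff[OF w fu(2)] L2eq_sym[OF e]]) (simp add: L2eq_def)
  also have "\<dots> = - lyap (lyap_eps k) f u"
    using lyap_diff_right[OF w fu(2) fu(1)] lyap_imaginary[OF fu(1)] by simp
  finally have "lyap_eps k * (L2norm f)\<^sup>2 \<le> 2 * lyap (lyap_eps k) f g" using lyap_dissipative[OF k A] by simp
  also have "\<dots> \<le> 4 * L2norm f * L2norm g"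
    using lyap_bound[OF fu(1) g, of "lyap_eps k"] lyap_eps_bounds[OF k] by simp
  finally have "L2norm f * (lyap_eps k * L2norm f) \<le> L2norm f * (4 * L2norm g)"
    by (simp add: power2_eq_square mult_ac)
  then have "lyap_eps k * L2norm f \<le> 4 * L2norm g" using pos by simp
  then show ?thesis using lyap_eps_bounds(1)[OF k] by (simp add: field_simps)
qed

section \<open>Solvability of the resolvent equation\<close>

text \<open>Variation of constants with the integrating factor exp(-s x).\<close>

lemma linear_ode:
  assumes b: "integrable I01 b"
  obtains y where "y 0 = c" "AC y (\<lambda>x. s * y x + b x)"
proof -
  define E where "E r x = exp (r * complex_of_real x)" for r :: complex and x
  have E: "AC (E r) (\<lambda>x. r * E r x)" for r
  proof (rule AC_C1)
    show "(E r has_vector_derivative r * E r x) (at x within {0..1})" for x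
      unfolding E_def by (auto intro!: derivative_eq_intros has_vector_derivative_real_field)
  qed (auto simp: E_def intro!: continuous_intros)
  have EE: "E s x * E (- s) x = 1" for x
    by (simp add: E_def flip: exp_add)
  have i: "integrable I01 (\<lambda>x. E (- s) x * b x)"
    by (rule integrable_I01_mult_continuous[OF AC_continuous[OF E] b])
  define y where "y x = E s x * (c + primitive (\<lambda>t. E (- s) t * b t) x)" for x
  have "AC y (\<lambda>x. s * E s x * (c + primitive (\<lambda>t. E (- s) t * b t) x) + E s x * (E (- s) x * b x))"
    unfolding y_def by (rule AC_mult[OF E AC_primitive[OF i]])
  moreover have "s * E s x * (c + primitive (\<lambda>t. E (- s) t * b t) x) + E s x * (E (- s) x * b x) = s * y x + b x" for x
    unfolding y_def using EE[of x] by (simp add: mult.assoc flip: mult.assoc[of "E s x"])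
  ultimately have "AC y (\<lambda>x. s * y x + b x)" by simp
  moreover have "y 0 = c" by (simp add: y_def E_def)
  ultimately show thesis by (rule that[rotated])
qed

text \<open>Factor \<open>D\<^sup>2 + \<omega> = (D - s) (D + s)\<close> with \<open>s\<^sup>2 = - \<omega>\<close>.\<close>

lemma second_order_ode:
  assumes G: "G \<in> L2"
  obtains h h1 where "h 0 = 0" "h1 0 = c" "H2_rep h h1 (\<lambda>x. G x - complex_of_real \<omega> * h x)"
proof -
  define s where "s = csqrt (- complex_of_real \<omega>)"
  have s: "s * s = - complex_of_real \<omega>" using power2_csqrt[of "- complex_of_real \<omega>"]
    unfolding s_def power2_eq_square .
  \<comment> \<open>\<open>y\<close> plays the role of (D + s) h. As \<open>h 0 = 0\<close>, its
    initial value is that of the derivative of \<open>h\<close>.\<close>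
  obtain y where y: "y 0 = c" "AC y (\<lambda>x. s * y x + G x)" by (rule linear_ode[OF L2_integrable[OF G]])
  obtain h where h: "h 0 = 0" "AC h (\<lambda>x. (- s) * h x + y x)"
    by (rule linear_ode[OF integrable_I01_continuous[OF AC_continuous[OF y(2)]]])
  define h1 where "h1 x = (- s) * h x + y x" for x
  have hh1: "AC h h1" unfolding h1_def by (rule h(2))
  have "AC (\<lambda>x. (- s) * h x + 1 * y x) (\<lambda>x. (- s) * h1 x + 1 * (s * y x + G x))"
    by (rule AC_lincomb[OF hh1 y(2)])
  then have "AC h1 (\<lambda>x. (- s) * h1 x + 1 * (s * y x + G x))" by (simp add: h1_def[abs_def])
  moreover have "(- s) * h1 x + 1 * (s * y x + G x) = G x - complex_of_real \<omega> * h x" for x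
  proof -
    have "(- s) * h1 x + 1 * (s * y x + G x) = G x + (s * s) * h x" by (simp add: h1_def algebra_simps)
    then show ?thesis by (simp add: s)
  qed
  ultimately have "AC h1 (\<lambda>x. G x - complex_of_real \<omega> * h x)" by (simp only:)
  moreover have "(\<lambda>x. G x - complex_of_real \<omega> * h x) \<in> L2"
    by (intro L2_diff L2_cmult G L2_continuous AC_continuous[OF hh1])
  ultimately have "H2_rep h h1 (\<lambda>x. G x - complex_of_real \<omega> * h x)" using hh1 by (simp add: H2_rep_AC)
  moreover have "h1 0 = c" by (simp add: h1_def h y)
  ultimately show thesis using h(1) that by blast
qed

lemma Agraph_of_H2_rep:
  assumes "H2_rep h h1 h2" "h 0 = 0" "h1 1 = - \<i> * complex_of_real k * h 1"
  shows "Agraph k h (\<lambda>x. - \<i> * h2 x)"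
proof -
  have "h \<in> L2" "(\<lambda>x. - \<i> * h2 x) \<in> L2"
    using assms(1) by (auto simp only: H2_rep_AC intro!: L2_continuous[of h] AC_continuous[of h h1] L2_cmult)
  then show ?thesis unfolding Agraph_def using assms by (auto simp: L2eq_def)
qed

text \<open>Otherwise \<open>h\<close> would be an eigenfunction for the eigenvalue i omega, and
  \<open>resolvent_bound\<close> with right-hand side 0 forces it to vanish almost everywhere,
  against \<open>h1 0 = 1\<close>.\<close>

lemma homogeneous_boundary_nonzero:
  assumes k: "k > 0" and H: "H2_rep h h1 (\<lambda>x. 0 - complex_of_real \<omega> * h x)" and h0: "h 0 = 0" "h1 0 = 1"
  shows "h1 1 + \<i> * complex_of_real k * h 1 \<noteq> 0"
proof
  assume "h1 1 + \<i> * complex_of_real k * h 1 = 0"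
  then have "h1 1 = - \<i> * complex_of_real k * h 1" by (simp add: eq_neg_iff_add_eq_0)
  note A = Agraph_of_H2_rep[OF H h0(1) this]
  have z: "(\<lambda>_. 0) \<in> L2" by (intro L2_continuous continuous_intros)
  have "L2norm h \<le> 4 / lyap_eps k * L2norm (\<lambda>_. 0)"
    by (rule resolvent_bound[OF k A z, of \<omega>]) (simp add: L2eq_def)
  moreover have "L2norm (\<lambda>_. 0) = 0" by (simp add: L2norm_I01)
  ultimately have "L2norm h = 0" using L2norm_nonneg[of h] by (metis mult_zero_right order_antisym)
  then have hz: "L2eq h (\<lambda>_. 0)" by (rule L2norm_eq_0_imp[OF Agraph_L2(1)[OF A]])
  have A1: "AC h1 (\<lambda>x. 0 - complex_of_real \<omega> * h x)" and Ah: "AC h h1" using H by (auto simp only: H2_rep_AC)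
  have "(\<lambda>x. 0 - complex_of_real \<omega> * h x) \<in> L2" using H by (auto simp only: H2_rep_AC)
  then have p0: "primitive (\<lambda>x. 0 - complex_of_real \<omega> * h x) x = primitive (\<lambda>_. 0) x" if "x \<in> {0..1}" for x
    by (rule primitive_cong_AE[OF _ z _ that]) (use hz in \<open>auto simp: L2eq_def elim!: eventually_mono\<close>)
  have pz: "primitive (\<lambda>_. 0) x = 0" for x by (simp add: primitive_def)
  \<comment> \<open>The second derivative is a.e. 0, so \<open>h1\<close> keeps its initial value
    and \<open>h\<close> is the identity on [0,1], which is not a null function.\<close>
  have h1: "h1 x = 1" if "x \<in> {0..1}" for x
    using AC_eq[OF A1 that] p0[OF that] pz h0 by simp
  have h: "h x = complex_of_real x" if x: "x \<in> {0..1}" for x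
  proof -
    have "primitive h1 x = primitive (\<lambda>_. 1) x" unfolding primitive_def
      by (rule set_lebesgue_integral_cong) (use h1 x in auto)
    also have "\<dots> = complex_of_real x" using AC_eq[OF AC_of_real x] by simp
    finally show ?thesis using AC_eq[OF Ah x] h0 by simp
  qed
  have "AE x in lborel. x \<in> {0..1} \<longrightarrow> x = (0::real)"
    using hz unfolding L2eq_def by eventually_elim (use h in auto)
  then have "AE x in lborel. x \<notin> {0<..1::real}" by eventually_elim auto
  then have "emeasure lborel {0<..1::real} = 0"
    by (subst (asm) AE_iff_measurable[of "{0<..1}"]) auto
  then show False by simp
qed

text \<open>Shooting from 0: a particular solution plus a multiple of the homogeneous one, adjusted
  to the condition at 1.\<close>

lemma resolvent_surj:
  assumes k: "k > 0" and g: "g \<in> L2"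
  shows "\<exists>f u. Agraph k f u \<and> L2eq (\<lambda>x. \<i> * complex_of_real \<omega> * f x - u x) g"
proof -
  \<comment> \<open>With u = -i f'' the resolvent equation reads f'' + omega f = -i g.\<close>
  have G: "(\<lambda>x. - \<i> * g x) \<in> L2" and z: "(\<lambda>_. 0) \<in> L2"
    using L2_cmult[OF g, of "- \<i>"] by (auto intro!: L2_continuous continuous_intros)
  obtain p p1 where p: "p 0 = 0" "p1 0 = 0" "H2_rep p p1 (\<lambda>x. - \<i> * g x - complex_of_real \<omega> * p x)"
    by (rule second_order_ode[OF G])
  obtain h h1 where h: "h 0 = 0" "h1 0 = 1" "H2_rep h h1 (\<lambda>x. 0 - complex_of_real \<omega> * h x)"
    by (rule second_order_ode[OF z])
  define d where "d = h1 1 + \<i> * complex_of_real k * h 1"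
  have d: "d \<noteq> 0" unfolding d_def by (rule homogeneous_boundary_nonzero[OF k h(3,1,2)])
  \<comment> \<open>Chosen to cancel the boundary functional f'(1) + i k f(1), whose value on
    \<open>h\<close> is \<open>d\<close>.\<close>
  define c where "c = - (p1 1 + \<i> * complex_of_real k * p 1) / d"
  define f where "f x = 1 * p x + c * h x" for x
  define f1 where "f1 x = 1 * p1 x + c * h1 x" for x
  define f2 where "f2 x = 1 * (- \<i> * g x - complex_of_real \<omega> * p x) + c * (0 - complex_of_real \<omega> * h x)" for x
  have "f2 \<in> L2" unfolding f2_def using p(3) h(3) by (intro L2_lincomb) (auto simp only: H2_rep_AC)
  moreover have "AC f1 f2" unfolding f1_def f2_def using p(3) h(3) by (intro AC_lincomb) (auto simp only: H2_rep_AC)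
  moreover have "AC f f1" unfolding f_def f1_def using p(3) h(3) by (intro AC_lincomb) (auto simp only: H2_rep_AC)
  ultimately have H: "H2_rep f f1 f2" by (simp add: H2_rep_AC)
  have "f1 1 + \<i> * complex_of_real k * f 1 = (p1 1 + \<i> * complex_of_real k * p 1) + c * d"
    by (simp add: f_def f1_def d_def algebra_simps)
  also have "\<dots> = 0" using d by (simp add: c_def)
  finally have "f1 1 = - \<i> * complex_of_real k * f 1" by (simp add: eq_neg_iff_add_eq_0)
  moreover have "f 0 = 0" by (simp add: f_def p h)
  ultimately have "Agraph k f (\<lambda>x. - \<i> * f2 x)" using Agraph_of_H2_rep[OF H] by blast
  moreover have "\<i> * complex_of_real \<omega> * f x - (- \<i> * f2 x) = g x" for x
    by (simp add: f_def f2_def algebra_simps)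
  ultimately show ?thesis by (intro exI[of _ f] exI[of _ "\<lambda>x. - \<i> * f2 x"]) (simp add: L2eq_def)
qed

section \<open>Density of the domain\<close>

lemma L2norm_tendsto_0_dominated:
  assumes f: "f \<in> L2" and d: "\<And>n. d n \<in> borel_measurable I01"
    and lim: "AE x in I01. (\<lambda>n. d n x) \<longlonglongrightarrow> f x"
    and F: "F \<in> L2" and dom: "\<And>n x. x \<in> {0..1} \<Longrightarrow> cmod (f x - d n x) \<le> cmod (F x)"
  shows "(\<lambda>n. L2norm (\<lambda>x. f x - d n x)) \<longlonglongrightarrow> 0"
proof -
  note [measurable] = L2_measurable[OF f] d
  have "(\<lambda>n. \<integral>x. (cmod (f x - d n x))\<^sup>2 \<partial>I01) \<longlonglongrightarrow> (\<integral>x. 0 \<partial>I01)"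
  proof (rule integral_dominated_convergence)
    show "AE x in I01. (\<lambda>n. (cmod (f x - d n x))\<^sup>2) \<longlonglongrightarrow> 0"
      using lim
    proof eventually_elim
      case (elim x)
      then have "(\<lambda>n. (cmod (f x - d n x))\<^sup>2) \<longlonglongrightarrow> (cmod (f x - f x))\<^sup>2" by (intro tendsto_intros)
      then show ?case by simp
    qed
    show "AE x in I01. norm ((cmod (f x - d n x))\<^sup>2) \<le> (cmod (F x))\<^sup>2" for n
      using dom by (intro AE_I2) (auto simp: space_I01 intro: power_mono)
    show "integrable I01 (\<lambda>x. (cmod (F x))\<^sup>2)" by (rule L2_integrable_square[OF F])
  qed measurable
  then have "(\<lambda>n. sqrt (\<integral>x. (cmod (f x - d n x))\<^sup>2 \<partial>I01)) \<longlonglongrightarrow> sqrt 0"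
    by (intro tendsto_real_sqrt) simp
  then show ?thesis by (simp add: L2norm_I01)
qed

text \<open>The simple zero at 0 and the double zero at 1 put every product of \<open>bump\<close>
  with a polynomial into the domain, for all \<open>k\<close> at once: value and derivative both
  vanish at 1. Positivity inside the interval allows division by it almost everywhere.\<close>

definition bump :: "real \<Rightarrow> real" where "bump x = x * (1 - x)\<^sup>2"

lemma bump_bounds: "x \<in> {0..1} \<Longrightarrow> 0 \<le> bump x" "x \<in> {0..1} \<Longrightarrow> bump x \<le> 1" "x \<in> {0<..<1} \<Longrightarrow> 0 < bump x"
  by (auto simp: bump_def intro!: mult_le_one power_le_one)

lemma continuous_on_bump [continuous_intros]: "continuous_on S bump"
  unfolding bump_def by (intro continuous_intros)

lemma Agraph_bump:
  assumes p: "polynomial_function p"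
  shows "\<exists>u. Agraph k (\<lambda>x. bump x *\<^sub>R p x) u"
proof -
  have db: "(bump has_real_derivative ((1 - x)\<^sup>2 - 2 * x * (1 - x))) (at x)" for x
    unfolding bump_def by (rule derivative_eq_intros refl | simp add: algebra_simps power2_eq_square)+
  obtain p' where p': "\<And>x. (p has_vector_derivative p' x) (at x)" 
    using has_vector_derivative_polynomial_function[OF p] by metis
  define h where "h x = bump x *\<^sub>R p x" for x
  have rb: "real_polynomial_function bump" 
    unfolding bump_def[abs_def] 
    by (intro real_polynomial_function.intros real_polynomial_function_power real_polynomial_function_diff
        bounded_linear_ident)
  then have "polynomial_function h" unfolding h_def
    by (intro polynomial_function_mult p) (simp add: real_polynomial_function_eq)
  then obtain h1 where h1: "polynomial_function h1" "\<And>x. (h has_vector_derivative h1 x) (at x)" 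
    using has_vector_derivative_polynomial_function by metis
  obtain h2 where h2: "polynomial_function h2" "\<And>x. (h1 has_vector_derivative h2 x) (at x)" 
    using has_vector_derivative_polynomial_function[OF h1(1)] by metis
  have "H2_rep h h1 h2" unfolding H2_rep_AC
    using h1 h2 by (auto intro!: L2_continuous AC_C1 continuous_on_polymonial_function intro: has_vector_derivative_at_within)
  moreover have "h 0 = 0" by (simp add: h_def bump_def)
  moreover have "h 1 = 0" by (simp add: h_def bump_def)
  moreover have "(h has_vector_derivative (bump 1 *\<^sub>R p' 1 + ((1 - 1)\<^sup>2 - 2 * 1 * (1 - 1)) *\<^sub>R p 1)) (at 1)"
    unfolding h_def by (rule has_vector_derivative_scaleR[OF db p'])
  then have "h1 1 = 0" using vector_derivative_unique_at[OF h1(2)[of 1]] by (simp add: bump_def)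
  ultimately have "Agraph k h (\<lambda>x. - \<i> * h2 x)" by (intro Agraph_of_H2_rep[where ?h1.0=h1]) auto
  then show ?thesis unfolding h_def by blast
qed

text \<open>A measurable function is an a.e. limit of continuous ones; the additional point is to
  keep the bound \<open>B\<close> for the approximants.\<close>

lemma continuous_approximation_AE:
  assumes f: "f \<in> borel_measurable I01" and B: "\<And>x. x \<in> {0..1} \<Longrightarrow> cmod (f x) \<le> B"
  obtains g where "\<And>n. continuous_on UNIV (g n)" "\<And>n x. cmod (g n x) \<le> B" 
    "AE x in I01. (\<lambda>n. g n x) \<longlonglongrightarrow> f x"
proof -
  define f' where "f' x = indicator {0..1} x *\<^sub>R f x" for x
  have B0: "0 \<le> B" using B[of 0] norm_ge_zero[of "f 0"] by (simp del: norm_ge_zero)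
  have "f' \<in> borel_measurable lborel" 
    using f unfolding borel_measurable_I01 set_borel_measurable_def f'_def .
  then have "f' \<in> borel_measurable lebesgue" by (rule measurable_completion)
  then have "f' measurable_on UNIV" by (rule lebesgue_measurable_imp_measurable_on) simp
  then obtain N g where N: "negligible N" and g: "\<And>n. continuous_on UNIV (g n)"
    and lim: "\<And>x. x \<notin> N \<Longrightarrow> (\<lambda>n. g n x) \<longlonglongrightarrow> f' x"
    unfolding measurable_on_def by auto
  \<comment> \<open>The projection onto the ball of radius \<open>B\<close> is continuous and fixes
    the values of \<open>f\<close> on [0,1], so composing with it preserves the limit.\<close>
  define c where "c = closest_point (cball (0::complex) B)"
  have c: "continuous_on UNIV c" unfolding c_def using B0 by (intro continuous_on_closest_point) auto
  show thesis
  proof (rule that[of "\<lambda>n x. c (g n x)"])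
    show "continuous_on UNIV (\<lambda>x. c (g n x))" for n
      by (rule continuous_on_compose2[OF c g]) auto
    show "cmod (c (g n x)) \<le> B" for n x
      using closest_point_in_set[of "cball (0::complex) B" "g n x"] B0 by (simp add: c_def)
    have "AE x in lborel. x \<notin> N"
      using N by (metis negligible_iff_null_sets AE_not_in AE_completion_iff)
    then have "AE x in lborel. x \<in> {0..1} \<longrightarrow> (\<lambda>n. c (g n x)) \<longlonglongrightarrow> f x"
    proof eventually_elim
      case (elim x)
      show ?case
      proof
        assume x: "x \<in> {0..1}"
        have "(\<lambda>n. c (g n x)) \<longlonglongrightarrow> c (f' x)"
          using c lim[OF elim] by (intro isCont_tendsto_compose[of _ c]) (auto simp: continuous_on_eq_continuous_at)
        moreover have "c (f' x) = f x"
          using B[OF x] x unfolding c_def by (subst closest_point_self) (auto simp: f'_def)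
        ultimately show "(\<lambda>n. c (g n x)) \<longlonglongrightarrow> f x" by simp
      qed
    qed
    then show "AE x in I01. (\<lambda>n. c (g n x)) \<longlonglongrightarrow> f x" by (simp add: AE_I01)
  qed
qed

text \<open>Dividing the continuous approximation by \<open>bump + 1/n\<close> before approximating it by a polynomial
  makes the product of that polynomial with \<open>bump\<close> an element of the domain.\<close>

lemma domain_dense_bounded:
  assumes f: "f \<in> borel_measurable I01" and B: "\<And>x. x \<in> {0..1} \<Longrightarrow> cmod (f x) \<le> B" and e: "0 < e"
  shows "\<exists>d u. Agraph k d u \<and> L2norm (\<lambda>x. f x - d x) < e"
proof -
  obtain g where g: "\<And>n. continuous_on UNIV (g n)" "\<And>n x. cmod (g n x) \<le> B" 
    and lim: "AE x in I01. (\<lambda>n. g n x) \<longlonglongrightarrow> f x"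
    using continuous_approximation_AE[OF f B] by metis
  have B0: "0 \<le> B" using g(2) norm_ge_zero order_trans by blast
  define q where "q n x = (1 / (bump x + 1 / Suc n)) *\<^sub>R g n x" for n x
  have pos: "0 < bump x + 1 / Suc n" if "x \<in> {0..1}" for x n
    using bump_bounds(1)[OF that] by (simp add: add_nonneg_pos)
  have "continuous_on {0..1} (q n)" for n unfolding q_def
    using pos[of _ n] continuous_on_subset[OF g(1)[of n], of "{0..1}"] 
    by (intro continuous_intros) (force simp del: of_nat_Suc)+
  then have "\<exists>p. polynomial_function p \<and> (\<forall>x\<in>{0..1}. cmod (q n x - p x) < 1 / Suc n)" for n
    by (intro Stone_Weierstrass_polynomial_function) auto
  then obtain p where p: "\<And>n. polynomial_function (p n)" and qp: "\<And>n x. x \<in> {0..1} \<Longrightarrow> cmod (q n x - p n x) < 1 / Suc n"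
    by metis
  define d where "d n x = bump x *\<^sub>R p n x" for n x
  have dq: "cmod (d n x - bump x *\<^sub>R q n x) \<le> 1 / Suc n" if x: "x \<in> {0..1}" for n x
  proof -
    have "cmod (d n x - bump x *\<^sub>R q n x) = bump x * cmod (q n x - p n x)"
      using bump_bounds(1)[OF x] by (simp add: d_def norm_minus_commute flip: scaleR_diff_right)
    also have "\<dots> \<le> 1 * (1 / Suc n)"
      using bump_bounds(1,2)[OF x] qp[OF x, of n] by (intro mult_mono) auto
    finally show ?thesis by simp
  qed
  have bq: "bump x *\<^sub>R q n x = (bump x / (bump x + 1 / Suc n)) *\<^sub>R g n x" for n x
    by (simp add: q_def)
  have lim0: "(\<lambda>n. 1 / real (Suc n)) \<longlonglongrightarrow> 0" by (rule LIMSEQ_Suc[OF lim_1_over_n])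
  have fL2: "f \<in> L2" by (rule L2_bounded[OF f B])
  have "(\<lambda>n. L2norm (\<lambda>x. f x - d n x)) \<longlonglongrightarrow> 0"
  proof (rule L2norm_tendsto_0_dominated[OF fL2])
    show "d n \<in> borel_measurable I01" for n
      unfolding d_def by (intro borel_measurable_I01_continuous continuous_intros continuous_on_polymonial_function p)
    show "(\<lambda>_. complex_of_real (2 * B + 1)) \<in> L2" by (intro L2_continuous continuous_intros)
    \<comment> \<open>\<open>B\<close> comes from \<open>f\<close>, another \<open>B\<close> from
      the regularised quotient, whose factor is at most 1, and 1 from the polynomial error.\<close>
    show "cmod (f x - d n x) \<le> cmod (complex_of_real (2 * B + 1))" if x: "x \<in> {0..1}" for n x
    proof -
      have "cmod (bump x *\<^sub>R q n x) \<le> 1 * B"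
        unfolding bq norm_scaleR using g(2)[of n x] pos[OF x, of n] bump_bounds(1)[OF x]
        by (intro mult_mono) (auto simp: divide_simps)
      moreover have "1 / real (Suc n) \<le> 1" by simp
      ultimately have "cmod (d n x) \<le> B + 1"
        using dq[OF x, of n] norm_triangle_sub[of "d n x" "bump x *\<^sub>R q n x"] by linarith
      then have "cmod (f x - d n x) \<le> 2 * B + 1"
        using B[OF x] norm_triangle_ineq4[of "f x" "d n x"] by linarith
      then show ?thesis unfolding norm_of_real by linarith
    qed
    \<comment> \<open>At the end points \<open>bump\<close> vanishes and so does \<open>d n\<close>;
      convergence is claimed only where \<open>bump\<close> is positive.\<close>
    have "AE x in I01. x \<in> {0<..<1}"
    proof -
      have "AE x in lborel. x \<in> {0..1} \<longrightarrow> x \<in> {0<..<1::real}"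
        using AE_lborel_singleton[of 0] AE_lborel_singleton[of 1] by eventually_elim auto
      then show ?thesis by (simp only: AE_I01)
    qed
    then show "AE x in I01. (\<lambda>n. d n x) \<longlonglongrightarrow> f x"
      using lim
    proof eventually_elim
      case (elim x)
      have "(\<lambda>n. (bump x / (bump x + 1 / Suc n)) *\<^sub>R g n x) \<longlonglongrightarrow> (bump x / (bump x + 0)) *\<^sub>R f x"
        using bump_bounds(3)[OF elim(1)] by (intro tendsto_intros lim0 elim(2)) auto
      then have "(\<lambda>n. bump x *\<^sub>R q n x) \<longlonglongrightarrow> f x"
        using bump_bounds(3)[OF elim(1)] by (simp add: bq)
      moreover have "(\<lambda>n. d n x - bump x *\<^sub>R q n x) \<longlonglongrightarrow> 0"
        by (rule Lim_null_comparison[OF _ lim0]) (use dq elim(1) in auto)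
      ultimately have "(\<lambda>n. bump x *\<^sub>R q n x + (d n x - bump x *\<^sub>R q n x)) \<longlonglongrightarrow> f x + 0"
        by (rule tendsto_add)
      then show ?case by simp
    qed
  qed
  then have "eventually (\<lambda>n. L2norm (\<lambda>x. f x - d n x) < e) sequentially"
    by (rule order_tendstoD) (rule e)
  then obtain n where "L2norm (\<lambda>x. f x - d n x) < e" by (auto simp: eventually_sequentially)
  moreover obtain u where "Agraph k (d n) u" unfolding d_def using Agraph_bump[OF p] by blast
  ultimately show ?thesis by blast
qed

text \<open>Truncating the large values reduces the claim to bounded functions; the truncation error
  is dominated by \<open>f\<close> itself.\<close>

lemma domain_dense:
  assumes f: "f \<in> L2" and e: "0 < e"
  shows "\<exists>d u. Agraph k d u \<and> L2norm (\<lambda>x. f x - d x) < e"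
proof -
  define t where "t n x = (if cmod (f x) \<le> real n then f x else 0)" for n x
  note [measurable] = L2_measurable[OF f]
  have t: "t n \<in> borel_measurable I01" for n unfolding t_def by measurable
  have tb: "cmod (t n x) \<le> real n" for n x by (simp add: t_def)
  have "(\<lambda>n. L2norm (\<lambda>x. f x - t n x)) \<longlonglongrightarrow> 0"
  proof (rule L2norm_tendsto_0_dominated[OF f t _ f])
    show "AE x in I01. (\<lambda>n. t n x) \<longlonglongrightarrow> f x"
    proof (intro AE_I2 tendsto_eventually)
      fix x
      obtain m where "cmod (f x) \<le> real m" using real_arch_simple by blast
      then show "eventually (\<lambda>n. t n x = f x) sequentially"
        by (intro eventually_sequentiallyI[of m]) (auto simp: t_def)
    qed
  qed (auto simp: t_def)
  then have "eventually (\<lambda>n. L2norm (\<lambda>x. f x - t n x) < e / 2) sequentially"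
    by (rule order_tendstoD) (use e in simp)
  then obtain n where n: "L2norm (\<lambda>x. f x - t n x) < e / 2" by (auto simp: eventually_sequentially)
  obtain d u where A: "Agraph k d u" and d: "L2norm (\<lambda>x. t n x - d x) < e / 2"
    using domain_dense_bounded[of "t n" "real n" "e/2" k, OF t tb] e by auto
  have "t n \<in> L2" by (rule L2_bounded[OF t tb])
  then have "L2norm (\<lambda>x. f x - d x) < e"
    using L2norm_triangle_diff[OF f _ Agraph_L2(1)[OF A], of "t n"] n d by simp
  with A show ?thesis by blast
qed

section \<open>Decay of the semigroup\<close>

text \<open>With a slack of slope \<open>e\<close>, the set of times at which the estimate holds is
  closed by continuity, and the right derivative pushes it beyond its supremum unless that is
  \<open>b\<close>.\<close>

lemma nonincreasing_right_derivative:
  fixes \<psi> :: "real \<Rightarrow> real"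
  assumes b: "0 \<le> b" and cont: "continuous_on {0..b} \<psi>"
    and deriv: "\<And>t. 0 \<le> t \<Longrightarrow> t < b \<Longrightarrow> \<exists>D\<le>0. (\<psi> has_real_derivative D) (at_right t)"
  shows "\<psi> b \<le> \<psi> 0"
proof (rule field_le_epsilon)
  fix e' :: real assume "0 < e'"
  \<comment> \<open>Dividing by \<open>b + 1\<close> instead of \<open>b\<close> covers
    \<open>b = 0\<close>.\<close>
  define e where "e = e' / (b + 1)"
  have e: "0 < e" "e * b \<le> e'" using \<open>0 < e'\<close> b by (auto simp: e_def field_simps)
  define S where "S = {t \<in> {0..b}. \<psi> t - e * t \<le> \<psi> 0}"
  have "closed S" unfolding S_def
    by (intro continuous_on_closed_Collect_le continuous_intros cont)
  have "bounded S" unfolding S_def by (rule bounded_subset[of "{0..b}"]) auto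
  have "0 \<in> S" using b by (simp add: S_def)
  with \<open>closed S\<close> \<open>bounded S\<close> have s: "Sup S \<in> S"
    by (intro closed_contains_Sup) (auto intro: bounded_imp_bdd_above)
  have "Sup S = b"
  proof (rule ccontr)
    assume "Sup S \<noteq> b"
    with s have sb: "0 \<le> Sup S" "Sup S < b" by (auto simp: S_def)
    then obtain D where "D \<le> 0" "(\<psi> has_real_derivative D) (at_right (Sup S))" using deriv by blast
    then have "((\<lambda>t. (\<psi> t - \<psi> (Sup S)) / (t - Sup S)) \<longlongrightarrow> D) (at_right (Sup S))"
      by (simp add: has_field_derivative_iff)
    then have "eventually (\<lambda>t. (\<psi> t - \<psi> (Sup S)) / (t - Sup S) < e) (at_right (Sup S))"
      by (rule order_tendstoD) (use \<open>D \<le> 0\<close> e in linarith)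
    moreover have "eventually (\<lambda>t. t \<in> {Sup S<..<b}) (at_right (Sup S))"
      by (rule eventually_at_right_real[OF sb(2)])
    ultimately have "eventually (\<lambda>t. t \<in> S \<and> Sup S < t) (at_right (Sup S))"
    proof eventually_elim
      case (elim t)
      then have "\<psi> t - \<psi> (Sup S) \<le> e * (t - Sup S)" by (simp add: pos_divide_less_eq)
      moreover have "\<psi> (Sup S) - e * Sup S \<le> \<psi> 0" using s by (simp add: S_def)
      ultimately show ?case using elim sb by (simp add: S_def algebra_simps)
    qed
    then obtain t where "t \<in> S" "Sup S < t"
      using eventually_happens[of _ "at_right (Sup S)"] by auto
    then show False using cSup_upper[of t S] bounded_imp_bdd_above[OF \<open>bounded S\<close>] by simp
  qed
  with s e show "\<psi> b \<le> \<psi> 0 + e'" by (simp add: S_def)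
qed

lemma lyap_tendsto:
  assumes F: "eventually (\<lambda>s. v s \<in> L2) F" and w: "w \<in> L2" and a: "a \<in> L2" and e: "0 \<le> \<epsilon>" "\<epsilon> \<le> 1/4"
    and lim: "((\<lambda>s. L2norm (\<lambda>x. v s x - w x)) \<longlongrightarrow> 0) F"
  shows "((\<lambda>s. lyap \<epsilon> a (v s)) \<longlongrightarrow> lyap \<epsilon> a w) F"
proof (rule LIM_zero_cancel, rule Lim_null_comparison)
  show "((\<lambda>s. 2 * L2norm a * L2norm (\<lambda>x. v s x - w x)) \<longlongrightarrow> 0) F"
    by (intro tendsto_mult_right_zero lim)
  show "eventually (\<lambda>s. norm (lyap \<epsilon> a (v s) - lyap \<epsilon> a w) \<le> 2 * L2norm a * L2norm (\<lambda>x. v s x - w x)) F"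
    using F
  proof eventually_elim
    case (elim s)
    show ?case using lyap_bound[OF a L2_diff[OF elim w] e] lyap_diff_right[OF elim w a] by simp
  qed
qed

text \<open>Expanding around \<open>w\<close> leaves a part linear in \<open>v s\<close>, covered by
  \<open>lyap_tendsto\<close>, and a remainder quadratic in the distance to
  \<open>w\<close>.\<close>

lemma lyap_self_tendsto:
  assumes F: "eventually (\<lambda>s. v s \<in> L2) F" and w: "w \<in> L2" and e: "0 \<le> \<epsilon>" "\<epsilon> \<le> 1/4"
    and lim: "((\<lambda>s. L2norm (\<lambda>x. v s x - w x)) \<longlongrightarrow> 0) F"
  shows "((\<lambda>s. lyap \<epsilon> (v s) (v s)) \<longlongrightarrow> lyap \<epsilon> w w) F"
proof -
  let ?d = "\<lambda>s x. v s x - w x"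
  have "((\<lambda>s. lyap \<epsilon> (?d s) (?d s)) \<longlongrightarrow> 0) F"
  proof (rule Lim_null_comparison)
    show "((\<lambda>s. 2 * (L2norm (?d s) * L2norm (?d s))) \<longlongrightarrow> 0) F"
      by (intro tendsto_mult_right_zero tendsto_mult_zero lim)
    show "eventually (\<lambda>s. norm (lyap \<epsilon> (?d s) (?d s)) \<le> 2 * (L2norm (?d s) * L2norm (?d s))) F"
      using F
    proof eventually_elim
      case (elim s)
      show ?case using lyap_bound[OF L2_diff[OF elim w] L2_diff[OF elim w] e] by simp
    qed
  qed
  then have "((\<lambda>s. 2 * lyap \<epsilon> w (v s) - lyap \<epsilon> w w + lyap \<epsilon> (?d s) (?d s)) \<longlongrightarrow> 2 * lyap \<epsilon> w w - lyap \<epsilon> w w + 0) F"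
    by (intro tendsto_intros lyap_tendsto[OF F w w e lim])
  moreover have "eventually (\<lambda>s. 2 * lyap \<epsilon> w (v s) - lyap \<epsilon> w w + lyap \<epsilon> (?d s) (?d s) = lyap \<epsilon> (v s) (v s)) F"
    using F
  proof eventually_elim
    case (elim s)
    show ?case using lyap_add_self[OF w L2_diff[OF elim w], of \<epsilon>] lyap_diff_right[OF elim w w, of \<epsilon>] by simp
  qed
  ultimately show ?thesis by (simp add: tendsto_cong)
qed

locale generated_semigroup =
  fixes k :: real and T :: "real \<Rightarrow> (real \<Rightarrow> complex) \<Rightarrow> real \<Rightarrow> complex"
  assumes k: "0 < k" and gen: "generated_by_A k T"
begin

lemma sg: "C0_semigroup T" using gen by (simp add: generated_by_A_def)

lemma T_L2: "0 \<le> t \<Longrightarrow> f \<in> L2 \<Longrightarrow> T t f \<in> L2"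
  using sg by (simp add: C0_semigroup_def)

lemma T_lincomb: "0 \<le> t \<Longrightarrow> f \<in> L2 \<Longrightarrow> g \<in> L2 \<Longrightarrow> L2eq (T t (\<lambda>x. a * f x + b * g x)) (\<lambda>x. a * T t f x + b * T t g x)"
  using sg by (simp add: C0_semigroup_def)

lemma T_diff: "0 \<le> t \<Longrightarrow> f \<in> L2 \<Longrightarrow> g \<in> L2 \<Longrightarrow> L2eq (T t (\<lambda>x. f x - g x)) (\<lambda>x. T t f x - T t g x)"
  using T_lincomb[of t f g 1 "-1"] by simp

lemma T_bounded:
  assumes "0 \<le> t" obtains B where "0 \<le> B" "\<And>f. f \<in> L2 \<Longrightarrow> L2norm (T t f) \<le> B * L2norm f"
proof -
  obtain B where B: "\<forall>f\<in>L2. L2norm (T t f) \<le> B * L2norm f" using sg assms by (auto simp: C0_semigroup_def)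
  show thesis
  proof (rule that[of "\<bar>B\<bar>"])
    show "L2norm (T t f) \<le> \<bar>B\<bar> * L2norm f" if "f \<in> L2" for f
      using B that by (meson L2norm_nonneg abs_ge_self mult_right_mono order_trans)
  qed simp
qed

lemma T_0: "f \<in> L2 \<Longrightarrow> L2eq (T 0 f) f"
  using sg by (simp add: C0_semigroup_def)

lemma T_add: "0 \<le> t \<Longrightarrow> 0 \<le> s \<Longrightarrow> f \<in> L2 \<Longrightarrow> L2eq (T (t + s) f) (T t (T s f))"
  using sg by (simp add: C0_semigroup_def)

lemma T_strongly_continuous: "f \<in> L2 \<Longrightarrow> ((\<lambda>h. L2norm (\<lambda>x. T h f x - f x)) \<longlongrightarrow> 0) (at_right 0)"
  using sg by (simp add: C0_semigroup_def)

section \<open>Continuity of orbits\<close>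

lemma L2norm_T_diff:
  assumes "0 \<le> s" "0 \<le> h" "f \<in> L2"
  shows "L2norm (\<lambda>x. T (s + h) f x - T s f x) = L2norm (T s (\<lambda>x. T h f x - f x))"
proof -
  have "L2norm (\<lambda>x. T (s + h) f x - T s f x) = L2norm (\<lambda>x. T s (T h f) x - T s f x)"
    using assms by (intro L2norm_diff_cong T_L2 T_add L2eq_refl) auto
  also have "\<dots> = L2norm (T s (\<lambda>x. T h f x - f x))"
    using assms by (intro L2norm_cong L2eq_sym[OF T_diff] L2_diff T_L2) auto
  finally show ?thesis .
qed

text \<open>Here the increment acts on the fixed vector \<open>T s f\<close>, which suits right
  continuity. The preceding version pulls \<open>T s\<close> out in front; it suits left continuity,
  where \<open>s\<close> varies and a bound uniform in \<open>s\<close> is required.\<close>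

lemma L2norm_T_diff':
  assumes "0 \<le> s" "0 \<le> h" "f \<in> L2"
  shows "L2norm (\<lambda>x. T (s + h) f x - T s f x) = L2norm (\<lambda>x. T h (T s f) x - T s f x)"
  using assms T_add[of h s f] by (intro L2norm_diff_cong T_L2 L2eq_refl) (auto simp: add.commute)

lemma T_right_continuous:
  assumes "0 \<le> t" "f \<in> L2"
  shows "((\<lambda>s. L2norm (\<lambda>x. T s f x - T t f x)) \<longlongrightarrow> 0) (at_right t)"
proof -
  have "eventually (\<lambda>h. L2norm (\<lambda>x. T h (T t f) x - T t f x) = L2norm (\<lambda>x. T (h + t) f x - T t f x)) (at_right 0)"
  proof (rule eventually_at_rightI[of 0 1])
    show "L2norm (\<lambda>x. T h (T t f) x - T t f x) = L2norm (\<lambda>x. T (h + t) f x - T t f x)" if "h \<in> {0<..<1}" for h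
      using L2norm_T_diff'[of t h f] assms that by (simp add: add.commute[of h t])
  qed simp
  then show ?thesis
    unfolding filterlim_at_right_to_0[of _ _ t]
    using T_strongly_continuous[OF T_L2[OF assms]] by (rule Lim_transform_eventually[rotated])
qed

text \<open>Baire category in the time variable: otherwise nested intervals would produce a time at which
  the operator is unbounded.\<close>

lemma bounded_on_some_interval:
  assumes \<eta>: "0 < \<eta>"
  obtains a b C where "0 < a" "a < b" "b < \<eta>" 
    "\<And>s f. s \<in> {a..b} \<Longrightarrow> f \<in> L2 \<Longrightarrow> L2norm (T s f) \<le> C * L2norm f"
proof (rule ccontr)
  note interval = that
  assume "\<not> thesis"
  have unb: "\<exists>s\<in>{a..b}. \<exists>f\<in>L2. C * L2norm f < L2norm (T s f)" if "0 < a" "a < b" "b < \<eta>" for a b C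
  proof (rule ccontr)
    assume "\<not> ?thesis"
    then have "L2norm (T s f) \<le> C * L2norm f" if "s \<in> {a..b}" "f \<in> L2" for s f
      using that by (meson not_less)
    with \<open>\<not> thesis\<close> show False using interval[OF that] by blast
  qed
  define P where "P n I \<longleftrightarrow> 0 < fst I \<and> fst I < snd I \<and> snd I < \<eta> \<and> 
      (\<forall>s\<in>{fst I..snd I}. \<exists>f\<in>L2. real n * L2norm f < L2norm (T s f))" for n and I :: "real \<times> real"
  have step: "\<exists>I. P n I \<and> a \<le> fst I \<and> snd I \<le> b" if ab: "0 < a" "a < b" "b < \<eta>" for n a b
  proof -
    obtain s f where s: "s \<in> {a..(a + b)/2}" and f: "f \<in> L2" "real n * L2norm f < L2norm (T s f)"
      using unb[of a "(a+b)/2" "real n"] ab by auto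
    \<comment> \<open>By right continuity of this single orbit, the violation of the bound
      \<open>n\<close> persists just after \<open>s\<close>. Taking \<open>s\<close> in the left
      half of the interval leaves room for that.\<close>
    have "eventually (\<lambda>r. L2norm (\<lambda>x. T r f x - T s f x) < L2norm (T s f) - real n * L2norm f) (at_right s)"
      using T_right_continuous[of s f] s ab f by (intro order_tendstoD) auto
    then obtain c where c: "c > s" "\<And>r. s < r \<Longrightarrow> r < c \<Longrightarrow> L2norm (\<lambda>x. T r f x - T s f x) < L2norm (T s f) - real n * L2norm f"
      unfolding eventually_at_right_field by blast
    define a' b' where "a' = s + (min c b - s) / 3" and "b' = s + (min c b - s) / 2"
    have o: "s < a'" "a' < b'" "b' < c" "b' < b" using c(1) s ab by (auto simp: a'_def b'_def min_def field_simps)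
    have "real n * L2norm f < L2norm (T r f)" if "r \<in> {a'..b'}" for r
    proof -
      have T: "T s f \<in> L2" "T r f \<in> L2" using s ab f that o by (auto intro!: T_L2)
      have "L2norm (T s f) \<le> L2norm (\<lambda>x. T s f x - T r f x) + L2norm (T r f)"
        using L2norm_triangle[OF L2_diff[OF T] T(2)] by simp
      then show ?thesis using c(2)[of r] that o L2norm_minus_commute[of "T s f" "T r f"] by auto
    qed
    then have "P n (a', b')" using o s ab f(1) unfolding P_def by (auto simp del: of_nat_less_iff intro!: bexI[of _ f])
    then show ?thesis using o s by (intro exI[of _ "(a', b')"]) auto
  qed
  obtain I where I: "\<And>n. P n (I n)" "\<And>n. fst (I n) \<le> fst (I (Suc n)) \<and> snd (I (Suc n)) \<le> snd (I n)"
  proof (rule dependent_nat_choice[of P "\<lambda>n I J. fst I \<le> fst J \<and> snd J \<le> snd I", THEN exE])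
    show "\<exists>x. P 0 x" using step[of "\<eta>/3" "\<eta>/2" 0] \<eta> by auto
    show "\<exists>J. P (Suc n) J \<and> fst I \<le> fst J \<and> snd J \<le> snd I" if "P n I" for I n
      using step[of "fst I" "snd I" "Suc n"] that by (auto simp: P_def)
  qed blast
  \<comment> \<open>A time common to all intervals violates every bound \<open>n\<close>, so the
    operator at that time is unbounded.\<close>
  have "(\<Inter>n. {fst (I n)..snd (I n)}) \<noteq> {}"
  proof (rule compact_nest)
    show "{fst (I n)..snd (I n)} \<subseteq> {fst (I m)..snd (I m)}" if "m \<le> n" for m n
      using that by (rule lift_Suc_antimono_le[of "\<lambda>n. {fst (I n)..snd (I n)}", rotated]) (use I(2) in auto)
  qed (use I(1) in \<open>auto simp: P_def less_imp_le\<close>)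
  then obtain r where r: "\<And>n. r \<in> {fst (I n)..snd (I n)}" by blast
  have "0 \<le> r" using r[of 0] I(1)[of 0] by (auto simp: P_def)
  then obtain B where B: "\<And>f. f \<in> L2 \<Longrightarrow> L2norm (T r f) \<le> B * L2norm f" using T_bounded by blast
  obtain n where n: "B \<le> real n" using real_arch_simple by blast
  obtain f where f: "f \<in> L2" "real n * L2norm f < L2norm (T r f)" using I(1)[of n] r[of n] unfolding P_def by blast
  then show False using B[OF f(1)] mult_right_mono[OF n L2norm_nonneg[of f]] by simp
qed

text \<open>Composing with the single bounded operator \<open>T (t - b)\<close> carries the good
  interval from {a..b} to one that ends at \<open>t\<close>.\<close>

lemma locally_bounded:
  assumes t: "0 < t"
  obtains \<delta> C where "0 < \<delta>" "0 \<le> C" "\<delta> < t" "\<And>s f. s \<in> {t - \<delta>..t} \<Longrightarrow> f \<in> L2 \<Longrightarrow> L2norm (T s f) \<le> C * L2norm f"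
proof -
  obtain a b C where ab: "0 < a" "a < b" "b < t" 
    and C: "\<And>s f. s \<in> {a..b} \<Longrightarrow> f \<in> L2 \<Longrightarrow> L2norm (T s f) \<le> C * L2norm f"
    using bounded_on_some_interval[OF t] by blast
  obtain B where B: "0 \<le> B" "\<And>f. f \<in> L2 \<Longrightarrow> L2norm (T (t - b) f) \<le> B * L2norm f"
    using T_bounded[of "t - b"] ab by auto
  show thesis
  proof (rule that[of "b - a" "B * \<bar>C\<bar>"])
    fix s f assume s: "s \<in> {t - (b - a)..t}" and f: "f \<in> L2"
    define r where "r = s - (t - b)"
    have r: "r \<in> {a..b}" "0 \<le> r" "s = (t - b) + r" using s ab by (auto simp: r_def)
    have "L2norm (T s f) = L2norm (T (t - b) (T r f))"
      unfolding r(3) using ab r f by (intro L2norm_cong T_add T_L2) auto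
    also have "\<dots> \<le> B * L2norm (T r f)" using r f by (intro B T_L2) auto
    also have "\<dots> \<le> B * (\<bar>C\<bar> * L2norm f)"
      using C[OF r(1) f] mult_right_mono[OF abs_ge_self[of C] L2norm_nonneg[of f]] B(1) by (intro mult_left_mono) auto
    finally show "L2norm (T s f) \<le> B * \<bar>C\<bar> * L2norm f" by simp
  qed (use ab B in auto)
qed

lemma T_left_continuous:
  assumes t: "0 < t" and f: "f \<in> L2"
  shows "((\<lambda>s. L2norm (\<lambda>x. T s f x - T t f x)) \<longlongrightarrow> 0) (at_left t)"
proof -
  obtain \<delta> C where \<delta>: "0 < \<delta>" "0 \<le> C" "\<delta> < t" 
    and C: "\<And>s f. s \<in> {t - \<delta>..t} \<Longrightarrow> f \<in> L2 \<Longrightarrow> L2norm (T s f) \<le> C * L2norm f"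
    using locally_bounded[OF t] by blast
  show ?thesis
  proof (rule Lim_null_comparison)
    show "eventually (\<lambda>s. norm (L2norm (\<lambda>x. T s f x - T t f x)) \<le> C * L2norm (\<lambda>x. T (t - s) f x - f x)) (at_left t)"
    proof (rule eventually_at_leftI[of "t - \<delta>"])
      fix s assume s: "s \<in> {t - \<delta><..<t}"
      \<comment> \<open>Writing \<open>t\<close> as \<open>s\<close> plus \<open>t - s\<close> lets
        \<open>T s\<close> be factored out; \<open>C\<close> bounds it uniformly as \<open>s\<close>
        approaches \<open>t\<close>.\<close>
      have "L2norm (\<lambda>x. T s f x - T t f x) = L2norm (T s (\<lambda>x. T (t - s) f x - f x))"
        using L2norm_T_diff[of s "t - s" f] L2norm_minus_commute[of "T s f" "T t f"] s \<delta> f by simp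
      also have "\<dots> \<le> C * L2norm (\<lambda>x. T (t - s) f x - f x)"
        using s f by (intro C L2_diff T_L2) auto
      finally show "norm (L2norm (\<lambda>x. T s f x - T t f x)) \<le> C * L2norm (\<lambda>x. T (t - s) f x - f x)" by simp
    qed (use \<delta> in simp)
    have "filterlim (\<lambda>s. t - s) (at_right 0) (at_left t)"
      by (auto simp: filterlim_at eventually_at_filter intro!: tendsto_eq_intros)
    then have "((\<lambda>s. L2norm (\<lambda>x. T (t - s) f x - f x)) \<longlongrightarrow> 0) (at_left t)"
      by (rule filterlim_compose[OF T_strongly_continuous[OF f]])
    then show "((\<lambda>s. C * L2norm (\<lambda>x. T (t - s) f x - f x)) \<longlongrightarrow> 0) (at_left t)"
      by (rule tendsto_mult_right_zero)
  qed
qed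

lemma T_continuous:
  assumes "0 \<le> t" "f \<in> L2"
  shows "((\<lambda>s. L2norm (\<lambda>x. T s f x - T t f x)) \<longlongrightarrow> 0) (at t within {0..})"
proof (cases "t = 0")
  case True
  then show ?thesis using T_right_continuous[OF assms] by (simp add: at_within_Ici_at_right)
next
  case False
  with assms have "((\<lambda>s. L2norm (\<lambda>x. T s f x - T t f x)) \<longlongrightarrow> 0) (at t)"
    using T_left_continuous T_right_continuous by (intro filterlim_split_at) auto
  then show ?thesis by (rule tendsto_within_subset) simp
qed

section \<open>The generator along orbits\<close>

lemma Agraph_iff:
  assumes "f \<in> L2" "u \<in> L2"
  shows "Agraph k f u \<longleftrightarrow> 
    ((\<lambda>h. L2norm (\<lambda>x. (T h f x - f x) / complex_of_real h - u x)) \<longlongrightarrow> 0) (at_right 0)"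
  using gen assms unfolding generated_by_A_def by blast

text \<open>\<open>T t\<close> commutes with \<open>T h\<close>, hence with the difference quotient
  at 0, and it is bounded, so it may be applied to the limit.\<close>

lemma Agraph_T:
  assumes t: "0 \<le> t" and A: "Agraph k f u"
  shows "Agraph k (T t f) (T t u)"
proof -
  note fu = Agraph_L2[OF A]
  obtain B where B: "0 \<le> B" "\<And>f. f \<in> L2 \<Longrightarrow> L2norm (T t f) \<le> B * L2norm f" using T_bounded[OF t] by blast
  have "((\<lambda>h. L2norm (\<lambda>x. (T h (T t f) x - T t f x) / complex_of_real h - T t u x)) \<longlongrightarrow> 0) (at_right 0)"
  proof (rule Lim_null_comparison)
    show "((\<lambda>h. B * L2norm (\<lambda>x. (T h f x - f x) / complex_of_real h - u x)) \<longlongrightarrow> 0) (at_right 0)"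
      using A Agraph_iff[OF fu] by (intro tendsto_mult_right_zero) blast
    show "eventually (\<lambda>h. norm (L2norm (\<lambda>x. (T h (T t f) x - T t f x) / complex_of_real h - T t u x)) \<le> B * L2norm (\<lambda>x. (T h f x - f x) / complex_of_real h - u x)) (at_right 0)"
    proof (rule eventually_at_rightI[of 0 1])
      fix h :: real assume h: "h \<in> {0<..<1}"
      define c where "c = 1 / complex_of_real h"
      let ?q = "\<lambda>x. c * (T h f x - f x) + (-1) * u x"
      let ?r = "\<lambda>x. c * (T t (T h f) x - T t f x) + (-1) * T t u x"
      have L: "T h f \<in> L2" "T t f \<in> L2" "T t u \<in> L2" "T h (T t f) \<in> L2" "T t (T h f) \<in> L2"
        using h t fu by (auto intro!: T_L2)
      have d: "(\<lambda>x. T h f x - f x) \<in> L2" and q: "?q \<in> L2" using L fu by (auto simp only: intro!: L2_diff L2_lincomb)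
      have r: "?r \<in> L2" using L by (intro L2_lincomb L2_diff)
      have e1: "L2eq (T t (T h f)) (T h (T t f))"
        using L2eq_trans[OF L2eq_sym[OF T_add[of t h f]] T_add[of h t f, folded add.commute[of t]]] h t fu
        by (simp add: add.commute)
      have e2: "L2eq (T t ?q) (\<lambda>x. c * T t (\<lambda>x. T h f x - f x) x + (-1) * T t u x)"
        by (rule T_lincomb[OF t d fu(2)])
      have e3: "L2eq (T t (\<lambda>x. T h f x - f x)) (\<lambda>x. T t (T h f) x - T t f x)"
        by (rule T_diff[OF t L(1) fu(1)])
      have "L2eq (\<lambda>x. (T h (T t f) x - T t f x) / complex_of_real h - T t u x) (T t ?q)"
        using e1 e2 e3 unfolding L2eq_I01 by eventually_elim (simp add: c_def)
      moreover have "(\<lambda>x. c * (T h (T t f) x - T t f x) + (-1) * T t u x) \<in> L2"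
        using L by (intro L2_lincomb L2_diff)
      then have "(\<lambda>x. (T h (T t f) x - T t f x) / complex_of_real h - T t u x) \<in> L2"
        by (simp add: c_def)
      ultimately have "L2norm (\<lambda>x. (T h (T t f) x - T t f x) / complex_of_real h - T t u x) = L2norm (T t ?q)"
        using T_L2[OF t q] by (intro L2norm_cong)
      also have "\<dots> \<le> B * L2norm ?q" by (rule B(2)[OF q])
      finally show "norm (L2norm (\<lambda>x. (T h (T t f) x - T t f x) / complex_of_real h - T t u x)) \<le> B * L2norm (\<lambda>x. (T h f x - f x) / complex_of_real h - u x)"
        by (simp add: c_def)
    qed simp
  qed
  then show ?thesis using Agraph_iff[OF T_L2[OF t fu(1)] T_L2[OF t fu(2)]] by blast
qed

section \<open>Derivative of the form along orbits and the decay estimate\<close>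

lemma lyap_deriv_0:
  assumes A: "Agraph k f u" and e: "0 \<le> \<epsilon>" "\<epsilon> \<le> 1/4"
  shows "((\<lambda>h. (lyap \<epsilon> (T h f) (T h f) - lyap \<epsilon> f f) / h) \<longlongrightarrow> 2 * lyap \<epsilon> f u) (at_right 0)"
proof -
  note fu = Agraph_L2[OF A]
  define r where "r h x = (T h f x - f x) / complex_of_real h" for h x
  have "r h = (\<lambda>x. (1 / complex_of_real h) * (T h f x - f x))" for h by (simp add: r_def fun_eq_iff)
  then have rL2: "r h \<in> L2" if "0 \<le> h" for h
    using L2_cmult[OF L2_diff[OF T_L2[OF that fu(1)] fu(1)], of "1 / complex_of_real h"] by simp
  have ev: "eventually (\<lambda>h. r h \<in> L2) (at_right 0)"
    by (rule eventually_at_rightI[of 0 1]) (use rL2 in auto)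
  have lim: "((\<lambda>h. L2norm (\<lambda>x. r h x - u x)) \<longlongrightarrow> 0) (at_right 0)"
    using A Agraph_iff[OF fu] unfolding r_def by blast
  \<comment> \<open>Since \<open>T h f\<close> is \<open>f\<close> plus \<open>h\<close> times
    \<open>r h\<close>, expanding the form leaves this expression as its difference quotient; the
    last term vanishes because \<open>r h\<close> converges.\<close>
  have "((\<lambda>h. 2 * lyap \<epsilon> f (r h) + h * lyap \<epsilon> (r h) (r h)) \<longlongrightarrow> 2 * lyap \<epsilon> f u + 0 * lyap \<epsilon> u u) (at_right 0)"
    by (intro tendsto_intros lyap_tendsto[OF ev fu(2) fu(1) e lim] lyap_self_tendsto[OF ev fu(2) e lim])
  then have "((\<lambda>h. 2 * lyap \<epsilon> f (r h) + h * lyap \<epsilon> (r h) (r h)) \<longlongrightarrow> 2 * lyap \<epsilon> f u) (at_right 0)" by simp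
  moreover have "eventually (\<lambda>h. 2 * lyap \<epsilon> f (r h) + h * lyap \<epsilon> (r h) (r h) = (lyap \<epsilon> (T h f) (T h f) - lyap \<epsilon> f f) / h) (at_right 0)"
  proof (rule eventually_at_rightI[of 0 1])
    fix h :: real assume h: "h \<in> {0<..<1}"
    define \<delta> where "\<delta> x = complex_of_real h * r h x" for x
    have r: "r h \<in> L2" and \<delta>: "\<delta> \<in> L2" using rL2[of h] h by (auto simp: \<delta>_def[abs_def] intro!: L2_cmult)
    have s: "lyap \<epsilon> g \<delta> = h * lyap \<epsilon> g (r h)" if "g \<in> L2" for g
      using lyap_lincomb_right[OF r r that, of \<epsilon> h 0] by (simp add: \<delta>_def[abs_def])
    have "T h f = (\<lambda>x. f x + \<delta> x)" using h by (auto simp: \<delta>_def r_def fun_eq_iff)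
    then have "lyap \<epsilon> (T h f) (T h f) = lyap \<epsilon> f f + 2 * lyap \<epsilon> f \<delta> + lyap \<epsilon> \<delta> \<delta>"
      using lyap_add_self[OF fu(1) \<delta>] by simp
    also have "lyap \<epsilon> \<delta> \<delta> = h * (h * lyap \<epsilon> (r h) (r h))"
      using s[OF \<delta>] s[OF r] lyap_commute[of \<epsilon> \<delta> "r h"] by simp
    finally show "2 * lyap \<epsilon> f (r h) + h * lyap \<epsilon> (r h) (r h) = (lyap \<epsilon> (T h f) (T h f) - lyap \<epsilon> f f) / h"
      using h s[OF fu(1)] by (simp add: field_simps)
  qed simp
  ultimately show ?thesis by (rule Lim_transform_eventually)
qed

lemma lyap_has_right_derivative:
  assumes t: "0 \<le> t" and A: "Agraph k f u" and e: "0 \<le> \<epsilon>" "\<epsilon> \<le> 1/4"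
  shows "((\<lambda>s. lyap \<epsilon> (T s f) (T s f)) has_real_derivative 2 * lyap \<epsilon> (T t f) (T t u)) (at_right t)"
proof -
  note fu = Agraph_L2[OF A]
  have "eventually (\<lambda>h. (lyap \<epsilon> (T h (T t f)) (T h (T t f)) - lyap \<epsilon> (T t f) (T t f)) / h
     = (lyap \<epsilon> (T (h + t) f) (T (h + t) f) - lyap \<epsilon> (T t f) (T t f)) / (h + t - t)) (at_right 0)"
  proof (rule eventually_at_rightI[of 0 1])
    fix h :: real assume h: "h \<in> {0<..<1}"
    have "lyap \<epsilon> (T h (T t f)) (T h (T t f)) = lyap \<epsilon> (T (h + t) f) (T (h + t) f)"
      using h t fu by (intro lyap_cong T_L2 L2eq_sym[OF T_add]) auto
    then show "(lyap \<epsilon> (T h (T t f)) (T h (T t f)) - lyap \<epsilon> (T t f) (T t f)) / h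
     = (lyap \<epsilon> (T (h + t) f) (T (h + t) f) - lyap \<epsilon> (T t f) (T t f)) / (h + t - t)" by simp
  qed simp
  then show ?thesis
    unfolding has_field_derivative_iff filterlim_at_right_to_0[of _ _ t]
    using lyap_deriv_0[OF Agraph_T[OF t A] e] by (rule Lim_transform_eventually[rotated])
qed

lemma exponential_decay_domain:
  assumes A: "Agraph k f u" and t: "0 \<le> t"
  shows "L2norm (T t f) \<le> 2 * exp (- (lyap_eps k / 4) * t) * L2norm f"
proof -
  note fu = Agraph_L2[OF A]
  note ek = lyap_eps_bounds[OF k]
  define \<phi> where "\<phi> s = lyap (lyap_eps k) (T s f) (T s f)" for s
  \<comment> \<open>The form is at most twice the squared norm, so the dissipation rate
    \<open>lyap_eps k\<close> halves when expressed through \<open>\<phi>\<close>. Taking the square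
    root of the final estimate halves it again and turns 2 times 2 into the factor 2.\<close>
  define \<mu> where "\<mu> = lyap_eps k / 2"
  have cont: "continuous_on {0..t} \<phi>"
    unfolding continuous_on_def \<phi>_def
  proof
    fix s assume "s \<in> {0..t}"
    then have s: "0 \<le> s" by simp
    have ev: "eventually (\<lambda>r. T r f \<in> L2) (at s within {0..})"
      unfolding eventually_at_filter by (rule always_eventually) (use T_L2 fu in auto)
    have "((\<lambda>r. lyap (lyap_eps k) (T r f) (T r f)) \<longlongrightarrow> lyap (lyap_eps k) (T s f) (T s f)) (at s within {0..})"
      using ek by (intro lyap_self_tendsto[OF ev T_L2[OF s fu(1)] _ _ T_continuous[OF s fu(1)]]) auto
    then show "((\<lambda>r. lyap (lyap_eps k) (T r f) (T r f)) \<longlongrightarrow> lyap (lyap_eps k) (T s f) (T s f)) (at s within {0..t})"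
      by (rule tendsto_within_subset) auto
  qed
  have "exp (\<mu> * t) * \<phi> t \<le> exp (\<mu> * 0) * \<phi> 0"
  proof (rule nonincreasing_right_derivative[OF t])
    show "continuous_on {0..t} (\<lambda>s. exp (\<mu> * s) * \<phi> s)" by (intro continuous_intros cont)
    fix s assume s: "0 \<le> s" "s < t"
    let ?D = "2 * lyap (lyap_eps k) (T s f) (T s u)"
    have D: "(\<phi> has_real_derivative ?D) (at_right s)"
      unfolding \<phi>_def using ek by (intro lyap_has_right_derivative s A) auto
    have "((\<lambda>s. exp (\<mu> * s) * \<phi> s) has_real_derivative (exp (\<mu> * s) * (\<mu> * \<phi> s + ?D))) (at_right s)"
      by (rule derivative_eq_intros D refl | simp add: algebra_simps)+
    moreover have "\<mu> * \<phi> s + ?D \<le> 0"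
    proof -
      have "\<phi> s \<le> 2 * (L2norm (T s f))\<^sup>2"
        using lyap_bound[OF T_L2[OF s(1) fu(1)] T_L2[OF s(1) fu(1)], of "lyap_eps k"] ek
        by (simp add: \<phi>_def power2_eq_square)
      then have "\<mu> * \<phi> s \<le> lyap_eps k * (L2norm (T s f))\<^sup>2"
        using ek mult_left_mono[of "\<phi> s" "2 * (L2norm (T s f))\<^sup>2" \<mu>] by (simp add: \<mu>_def)
      then show ?thesis using lyap_dissipative[OF k Agraph_T[OF s(1) A]] by simp
    qed
    ultimately show "\<exists>D\<le>0. ((\<lambda>s. exp (\<mu> * s) * \<phi> s) has_real_derivative D) (at_right s)"
      by (intro exI[of _ "exp (\<mu> * s) * (\<mu> * \<phi> s + ?D)"]) (simp add: mult_nonneg_nonpos)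
  qed
  then have "\<phi> t \<le> exp (- \<mu> * t) * \<phi> 0" by (simp add: exp_minus field_simps)
  also have "\<phi> 0 = lyap (lyap_eps k) f f"
    unfolding \<phi>_def using fu by (intro lyap_cong T_L2 T_0) auto
  also have "\<dots> \<le> 2 * (L2norm f)\<^sup>2"
    using lyap_bound[OF fu(1) fu(1), of "lyap_eps k"] ek by (simp add: power2_eq_square)
  finally have "\<phi> t \<le> exp (- \<mu> * t) * (2 * (L2norm f)\<^sup>2)" by simp
  then have "(L2norm (T t f))\<^sup>2 \<le> 4 * (exp (- \<mu> * t) * (L2norm f)\<^sup>2)"
    using lyap_lower[OF T_L2[OF t fu(1)], of "lyap_eps k"] ek by (simp add: \<phi>_def)
  also have "exp (- \<mu> * t) = (exp (- (lyap_eps k / 4) * t))\<^sup>2"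
    by (simp add: \<mu>_def flip: exp_double)
  finally have "(L2norm (T t f))\<^sup>2 \<le> (2 * exp (- (lyap_eps k / 4) * t) * L2norm f)\<^sup>2"
    by (simp add: power_mult_distrib)
  then show ?thesis by (rule power2_le_imp_le) simp
qed

text \<open>The estimate passes from the dense domain to all of L^2 because \<open>T t\<close> is
  bounded; the bound \<open>B\<close> disappears in the limit.\<close>

lemma exponential_decay:
  assumes t: "0 \<le> t" and f: "f \<in> L2"
  shows "L2norm (T t f) \<le> 2 * exp (- (lyap_eps k / 4) * t) * L2norm f"
proof (rule field_le_epsilon)
  fix e :: real assume e: "0 < e"
  define M where "M = 2 * exp (- (lyap_eps k / 4) * t)"
  have M: "0 < M" by (simp add: M_def)
  obtain B where B: "0 \<le> B" "\<And>f. f \<in> L2 \<Longrightarrow> L2norm (T t f) \<le> B * L2norm f" using T_bounded[OF t] by blast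
  \<comment> \<open>\<open>B * \<delta>\<close> pays for moving from \<open>f\<close> to
    \<open>d\<close> under \<open>T t\<close>, \<open>M * \<delta>\<close> for replacing the norm of
    \<open>d\<close> by that of \<open>f\<close>.\<close>
  define \<delta> where "\<delta> = e / (B + M)"
  have \<delta>: "0 < \<delta>" "(B + M) * \<delta> = e" using e B(1) M by (auto simp: \<delta>_def field_simps)
  obtain d u where A: "Agraph k d u" and d: "L2norm (\<lambda>x. f x - d x) < \<delta>" using domain_dense[OF f \<delta>(1)] by blast
  note dL2 = Agraph_L2(1)[OF A]
  note L = f dL2 L2_diff[OF f dL2] T_L2[OF t f] T_L2[OF t dL2] T_L2[OF t L2_diff[OF f dL2]]
  have "L2norm (T t f) \<le> L2norm (\<lambda>x. T t f x - T t d x) + L2norm (T t d)"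
    using L2norm_triangle[OF L2_diff[OF L(4,5)] L(5)] by simp
  also have "L2norm (\<lambda>x. T t f x - T t d x) = L2norm (T t (\<lambda>x. f x - d x))"
    by (rule L2norm_cong[OF L2_diff[OF L(4,5)] L(6) L2eq_sym[OF T_diff[OF t L(1,2)]]])
  also have "\<dots> \<le> B * \<delta>" using B(2)[OF L(3)] mult_left_mono[OF less_imp_le[OF d] B(1)] by simp
  also have "L2norm (T t d) \<le> M * L2norm d" using exponential_decay_domain[OF A t] by (simp add: M_def)
  also have "M * L2norm d \<le> M * (L2norm f + \<delta>)"
  proof (rule mult_left_mono)
    have "L2norm d \<le> L2norm (\<lambda>x. d x - f x) + L2norm f" using L2norm_triangle[OF L2_diff[OF dL2 f] f] by simp
    then show "L2norm d \<le> L2norm f + \<delta>" using d L2norm_minus_commute[of f d] by simp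
  qed (use M in simp)
  finally have "L2norm (T t f) \<le> M * L2norm f + (B + M) * \<delta>" by (simp add: algebra_simps)
  then show "L2norm (T t f) \<le> 2 * exp (- (lyap_eps k / 4) * t) * L2norm f + e" unfolding \<delta>(2) by (simp add: M_def)
qed

end

text \<open>The first half describes a bounded inverse: solvability is surjectivity of i omega - A,
  and the estimate at \<open>g = 0\<close> is its injectivity. The constant is
  \<open>4 / lyap_eps k\<close> for every \<open>\<omega>\<close>.\<close>

theorem theorem1:
  fixes k :: real
  assumes "k > 0"
  shows "(\<exists>C. \<forall>\<omega>::real. \<forall>g\<in>L2.
            (\<exists>f u. Agraph k f u \<and> L2eq (\<lambda>x. \<i> * complex_of_real \<omega> * f x - u x) g) \<and>
            (\<forall>f u. Agraph k f u \<and> L2eq (\<lambda>x. \<i> * complex_of_real \<omega> * f x - u x) g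
                 \<longrightarrow> L2norm f \<le> C * L2norm g))
       \<and> (\<forall>T. generated_by_A k T \<longrightarrow>
            (\<exists>M>0. \<exists>\<mu>>0. \<forall>t\<ge>0. \<forall>f\<in>L2. L2norm (T t f) \<le> M * exp (- \<mu> * t) * L2norm f))"
proof (intro conjI allI impI)
  show "\<exists>C. \<forall>\<omega>::real. \<forall>g\<in>L2.
            (\<exists>f u. Agraph k f u \<and> L2eq (\<lambda>x. \<i> * complex_of_real \<omega> * f x - u x) g) \<and>
            (\<forall>f u. Agraph k f u \<and> L2eq (\<lambda>x. \<i> * complex_of_real \<omega> * f x - u x) g
                 \<longrightarrow> L2norm f \<le> C * L2norm g)"
    using resolvent_surj[OF assms] resolvent_bound[OF assms] by blast
  fix T assume "generated_by_A k T"
  with assms interpret generated_semigroup k T by unfold_locales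
  show "\<exists>M>0. \<exists>\<mu>>0. \<forall>t\<ge>0. \<forall>f\<in>L2. L2norm (T t f) \<le> M * exp (- \<mu> * t) * L2norm f"
  proof (intro exI conjI allI impI ballI)
    show "L2norm (T t f) \<le> 2 * exp (- (lyap_eps k / 4) * t) * L2norm f" if "0 \<le> t" "f \<in> L2" for t f
      using that by (rule exponential_decay)
  qed (use lyap_eps_bounds(1)[OF assms] in auto)
qed

end
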